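(* Assume Condition D and that $(H_1,H_2)$ is $U$-controllable. Let $\rho(0)$ be any density matrix on $\mathbb C^N$ and $\rho(t)=X(t)\rho(0)X(t)^*$. Then with probability one $\rho(t)\xrightarrow{c}\frac1NE$ as $t\to\infty$.
   Context: $H_1,H_2$ Hermitian $N\times N$, $U_k^t=e^{-itH_k}$; $J_n(s_1,\dots,s_n)=U_{k_n}^{s_n}\cdots U_{k_2}^{s_2}U_1^{s_1}$ with $k_j=1$ for odd $j$, $k_j=2$ for even $j$; $(H_1,H_2)$ is $U$-controllable if $\{J_n(s):s_j\ge0\}=U(N)$ for some $n$. Condition D: $\tau_1,\tau_2,\dots$ i.i.d. positive with $\mathbb E\tau_1<\infty$ and a density positive on $[0,\infty)$; $t_0=0$, $t_n=\tau_1+\dots+\tau_n$. $X(t)=J_n(\tau_1,\dots,\tau_{n-1},t-t_{n-1})$ for $t_{n-1}\le t<t_n$ (so $\rho(t)$ solves $\dot\rho=-i[H(t),\rho]$ with $H(t)=H_1$ on $[t_{2k},t_{2k+1})$ and $H_2$ on $[t_{2k+1},t_{2k+2})$). A density matrix is a nonnegative Hermitian $\rho$ with $\mathrm{Tr}\rho=1$. $\rho(t)\xrightarrow{c}\rho$ means $\frac1T\int_0^T\mathrm{Tr}(\rho(t)A)dt\to\mathrm{Tr}(\rho A)$ for every Hermitian $A$. $E$ is the identity. *)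

theory Defs
  imports "HOL-Analysis.Analysis" "HOL-Probability.Probability"
begin

type_synonym 'n cmat = "complex^'n^'n"

definition cadj :: "'n::finite cmat \<Rightarrow> 'n cmat" where
  "cadj A = (\<chi> i j. cnj (A $ j $ i))"

definition hermitian :: "'n::finite cmat \<Rightarrow> bool" where
  "hermitian A \<longleftrightarrow> cadj A = A"

definition unitary_group :: "'n::finite cmat set" where
  "unitary_group = {U. cadj U ** U = mat 1}"

definition density_matrix :: "'n::finite cmat \<Rightarrow> bool" where
  "density_matrix \<rho> \<longleftrightarrow> hermitian \<rho>
     \<and> (\<forall>v::complex^'n. 0 \<le> Re (\<Sum>i\<in>UNIV. cnj (v $ i) * (\<rho> *v v) $ i))
     \<and> trace \<rho> = 1"

definition cscale :: "complex \<Rightarrow> 'n::finite cmat \<Rightarrow> 'n cmat" where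
  "cscale c A = (\<chi> i j. c * A $ i $ j)"

primrec matpow :: "'n::finite cmat \<Rightarrow> nat \<Rightarrow> 'n cmat" where
  "matpow A 0 = mat 1"
| "matpow A (Suc k) = A ** matpow A k"

definition mexp :: "'n::finite cmat \<Rightarrow> 'n cmat" where
  "mexp A = (\<Sum>k. (1 / fact k) *\<^sub>R matpow A k)"

definition evol :: "'n::finite cmat \<Rightarrow> real \<Rightarrow> 'n cmat" where
  "evol H t = mexp (cscale (- \<i> * complex_of_real t) H)"

text \<open>J_n(s_1,...,s_n) = U_{k_n}^{s_n} ... U_{k_1}^{s_1}, with k_j = 1 for odd j and
  k_j = 2 for even j.  The times are given as a function s with s j = s_j (j \<ge> 1).\<close>
primrec Jprod :: "'n::finite cmat \<Rightarrow> 'n cmat \<Rightarrow> nat \<Rightarrow> (nat \<Rightarrow> real) \<Rightarrow> 'n cmat" where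
  "Jprod H1 H2 0 s = mat 1"
| "Jprod H1 H2 (Suc n) s =
     evol (if odd (Suc n) then H1 else H2) (s (Suc n)) ** Jprod H1 H2 n s"

definition U_controllable :: "'n::finite cmat \<Rightarrow> 'n cmat \<Rightarrow> bool" where
  "U_controllable H1 H2 \<longleftrightarrow>
     (\<exists>n. {Jprod H1 H2 n s | s. \<forall>j\<in>{1..n}. 0 \<le> s j} = unitary_group)"

text \<open>Switching times: tau j is tau_{j+1} of the paper; t_n = tau_1 + ... + tau_n.\<close>
definition switch_time :: "(nat \<Rightarrow> 'a \<Rightarrow> real) \<Rightarrow> 'a \<Rightarrow> nat \<Rightarrow> real" where
  "switch_time tau \<omega> n = (\<Sum>j<n. tau j \<omega>)"

text \<open>X(t) = J_n(tau_1,...,tau_{n-1}, t - t_{n-1}) for t_{n-1} \<le> t < t_n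
  (n is the least index with t < t_n).\<close>
definition Xpath :: "'n::finite cmat \<Rightarrow> 'n cmat \<Rightarrow> (nat \<Rightarrow> 'a \<Rightarrow> real) \<Rightarrow> 'a \<Rightarrow> real \<Rightarrow> 'n cmat" where
  "Xpath H1 H2 tau \<omega> t =
     (let n = (LEAST n. t < switch_time tau \<omega> n)
      in Jprod H1 H2 n
           (\<lambda>j. if j < n then tau (j - 1) \<omega> else t - switch_time tau \<omega> (n - 1)))"

end

theory Submission
  imports Defs
begin

text \<open>
Subtracting \<open>E/N\<close> from \<open>\<rho>(0)\<close> leaves a traceless matrix \<open>x\<^sub>0\<close>, and
everything in sight is linear in it. Between switches the state moves by linear isometries of the
Euclidean space of matrices, so \<open>x\<^sub>j\<^sub>+\<^sub>1 = T\<^sub>p(\<tau>\<^sub>j) x\<^sub>j\<close>, where \<open>p\<close> is the parity of \<open>j\<close>. With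
\<open>\<Phi>\<^sub>p v = \<^bold>E T\<^sub>p(\<tau>) v\<close>, a strong law for martingale transforms shows that the Cesaro averages
\<open>c\<^sub>p\<close> of the \<open>x\<^sub>j\<close> of parity \<open>p\<close> satisfy \<open>c\<^sub>1\<^sub>-\<^sub>p - \<Phi>\<^sub>p c\<^sub>p \<longlonglongrightarrow> 0\<close>. By strict convexity of the norm
and positivity of the density, a fixed vector of \<open>\<Phi>\<^sub>1 \<Phi>\<^sub>0\<close> is fixed by all \<open>T\<^sub>p(s)\<close>, hence by
controllability commutes with all of \<open>U(N)\<close> and is scalar. The orbit stays orthogonal to the scalars,
where \<open>1 - \<Phi>\<^sub>1 \<Phi>\<^sub>0\<close> is therefore bounded below, and so \<open>c\<^sub>p \<longlonglongrightarrow> 0\<close>. The strong law applied to the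
integrals over the single intervals and to the switching times themselves passes from these discrete
averages to the time average.
\<close>

section \<open>A strong law for martingale transforms of i.i.d. times\<close>

text \<open>By monotone convergence the series of the \<open>Q n\<close> has finite expectation, so
  it converges almost everywhere and its terms vanish in the limit. This does the work of
  Borel-Cantelli below, both for squared averages and for counts of large values.\<close>

lemma AE_tendsto_zero_of_summable_integrals:
  fixes Q :: "nat \<Rightarrow> 'a \<Rightarrow> real"
  assumes int: "\<And>n. integrable M (Q n)" and nonneg: "\<And>n \<omega>. 0 \<le> Q n \<omega>"
    and sum: "summable (\<lambda>n. integral\<^sup>L M (Q n))"
  shows "AE \<omega> in M. (\<lambda>n. Q n \<omega>) \<longlonglongrightarrow> 0"
proof -
  have [measurable]: "\<And>n. Q n \<in> borel_measurable M"
    using int by auto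
  have "(\<integral>\<^sup>+\<omega>. (\<Sum>n. ennreal (Q n \<omega>)) \<partial>M) = (\<Sum>n. \<integral>\<^sup>+\<omega>. ennreal (Q n \<omega>) \<partial>M)"
    by (rule nn_integral_suminf) auto
  also have "\<dots> = (\<Sum>n. ennreal (integral\<^sup>L M (Q n)))"
    using int nonneg by (subst nn_integral_eq_integral) auto
  also have "\<dots> = ennreal (\<Sum>n. integral\<^sup>L M (Q n))"
    using sum nonneg by (intro suminf_ennreal2) auto
  also have "\<dots> \<noteq> \<infinity>" by simp
  finally have "AE \<omega> in M. (\<Sum>n. ennreal (Q n \<omega>)) \<noteq> \<infinity>"
    by (intro nn_integral_noteq_infinite) auto
  then show ?thesis
  proof eventually_elim
    case (elim \<omega>)
    have "summable (\<lambda>n. Q n \<omega>)"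
      using elim nonneg by (intro summable_suminf_not_top) auto
    then show ?case by (rule summable_LIMSEQ_zero)
  qed
qed

lemma sq_le_of_abs_le: "\<bar>a\<bar> \<le> b \<Longrightarrow> a\<^sup>2 \<le> b\<^sup>2" for a b :: real
  using power_mono[of "\<bar>a\<bar>" b 2] by simp

section \<open>Independent identically distributed times and functions of their past\<close>

locale iid_times = prob_space M for M :: "'a measure" +
  fixes tau :: "nat \<Rightarrow> 'a \<Rightarrow> real"
  assumes tau_measurable [measurable]: "\<And>i. tau i \<in> borel_measurable M"
    and tau_indep: "indep_vars (\<lambda>_. borel) tau UNIV"
    and tau_ident: "\<And>i. distr M borel (tau i) = distr M borel (tau 0)"
begin

text \<open>A Borel factorization through the times with index below \<open>n\<close> takes the
  place of a filtration. As \<open>tau n\<close> is not among these times, a weight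
  \<open>w n\<close> with \<open>adapted n (w n)\<close> is predictable for the step driven by
  \<open>tau n\<close>.\<close>

definition adapted :: "nat \<Rightarrow> ('a \<Rightarrow> real) \<Rightarrow> bool" where
  "adapted n Y \<longleftrightarrow> (\<exists>g\<in>borel_measurable (PiM {..<n} (\<lambda>_. borel)).
     \<forall>\<omega>. Y \<omega> = g (restrict (\<lambda>i. tau i \<omega>) {..<n}))"

lemma adapted_measurable:
  assumes "adapted n Y" shows "Y \<in> borel_measurable M"
proof -
  obtain g where g [measurable]: "g \<in> borel_measurable (PiM {..<n} (\<lambda>_. borel :: real measure))"
    and Y: "\<And>\<omega>. Y \<omega> = g (restrict (\<lambda>i. tau i \<omega>) {..<n})"
    using assms unfolding adapted_def by blast
  have "(\<lambda>\<omega>. g (restrict (\<lambda>i. tau i \<omega>) {..<n})) \<in> borel_measurable M"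
    by measurable
  then show ?thesis unfolding Y .
qed

lemma adapted_const: "adapted n (\<lambda>_. c)"
  unfolding adapted_def by (intro bexI[of _ "\<lambda>_. c"]) auto

lemma adapted_mono:
  assumes "adapted m Y" "m \<le> n" shows "adapted n Y"
proof -
  obtain g where g: "g \<in> borel_measurable (PiM {..<m} (\<lambda>_. borel :: real measure))"
    and Y: "\<And>\<omega>. Y \<omega> = g (restrict (\<lambda>i. tau i \<omega>) {..<m})"
    using assms unfolding adapted_def by blast
  have sub: "{..<m} \<subseteq> {..<n}" using assms by auto
  have "(\<lambda>f. g (restrict f {..<m})) \<in> borel_measurable (PiM {..<n} (\<lambda>_. borel :: real measure))"
    using measurable_compose[OF measurable_restrict_subset[OF sub] g] .
  moreover have "{..<n} \<inter> {..<m} = {..<m}" using sub by auto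
  ultimately show ?thesis
    unfolding adapted_def Y by (intro bexI[of _ "\<lambda>f. g (restrict f {..<m})"]) auto
qed

lemma adapted_compose2:
  assumes "adapted n Y" "adapted n Z"
    and k: "case_prod k \<in> borel_measurable (borel \<Otimes>\<^sub>M borel)"
  shows "adapted n (\<lambda>\<omega>. k (Y \<omega>) (Z \<omega>))"
proof -
  obtain g where [measurable]: "g \<in> borel_measurable (PiM {..<n} (\<lambda>_. borel :: real measure))"
    and Y: "\<And>\<omega>. Y \<omega> = g (restrict (\<lambda>i. tau i \<omega>) {..<n})"
    using assms unfolding adapted_def by blast
  obtain g' where [measurable]: "g' \<in> borel_measurable (PiM {..<n} (\<lambda>_. borel :: real measure))"
    and Z: "\<And>\<omega>. Z \<omega> = g' (restrict (\<lambda>i. tau i \<omega>) {..<n})"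
    using assms unfolding adapted_def by blast
  have "(\<lambda>f. case_prod k (g f, g' f)) \<in> borel_measurable (PiM {..<n} (\<lambda>_. borel :: real measure))"
    by (rule measurable_compose[OF _ k]) measurable
  then show ?thesis
    unfolding adapted_def Y Z by (intro bexI[of _ "\<lambda>f. k (g f) (g' f)"]) auto
qed

lemma adapted_add: "adapted n Y \<Longrightarrow> adapted n Z \<Longrightarrow> adapted n (\<lambda>\<omega>. Y \<omega> + Z \<omega>)"
  by (rule adapted_compose2) auto

lemma adapted_mult: "adapted n Y \<Longrightarrow> adapted n Z \<Longrightarrow> adapted n (\<lambda>\<omega>. Y \<omega> * Z \<omega>)"
  by (rule adapted_compose2) auto

lemma adapted_sum:
  "(\<And>i. i \<in> I \<Longrightarrow> adapted n (Y i)) \<Longrightarrow> adapted n (\<lambda>\<omega>. \<Sum>i\<in>I. Y i \<omega>)"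
  by (induction I rule: infinite_finite_induct) (auto intro: adapted_const adapted_add)

lemma adapted_tau:
  assumes "j < n" "h \<in> borel_measurable borel"
  shows "adapted n (\<lambda>\<omega>. h (tau j \<omega>))"
  unfolding adapted_def
  using assms by (intro bexI[of _ "\<lambda>f. h (f j)"]) (auto intro!: measurable_compose[OF _ assms(2)] measurable_component_singleton)

text \<open>The index blocks \<open>{..<n}\<close> and \<open>{n}\<close> are disjoint, so the
  corresponding tuples of times are independent, and so are Borel functions of them.\<close>

lemma indep_adapted:
  assumes "adapted n Y" and h: "h \<in> borel_measurable borel"
  shows "indep_var borel Y borel (\<lambda>\<omega>. h (tau n \<omega>) :: real)"
proof -
  obtain g where g: "g \<in> borel_measurable (PiM {..<n} (\<lambda>_. borel :: real measure))"
    and Y: "\<And>\<omega>. Y \<omega> = g (restrict (\<lambda>i. tau i \<omega>) {..<n})"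
    using assms unfolding adapted_def by blast
  have "indep_var (PiM {..<n} (\<lambda>_. borel)) (\<lambda>\<omega>. restrict (\<lambda>i. tau i \<omega>) {..<n})
     (PiM {n} (\<lambda>_. borel)) (\<lambda>\<omega>. restrict (\<lambda>i. tau i \<omega>) {n})"
    by (rule indep_var_restrict[OF tau_indep]) auto
  moreover have "(\<lambda>f. h (f n)) \<in> borel_measurable (PiM {n} (\<lambda>_. borel))"
    by (rule measurable_compose[OF _ h]) (auto intro!: measurable_component_singleton)
  ultimately have "indep_var borel (g \<circ> (\<lambda>\<omega>. restrict (\<lambda>i. tau i \<omega>) {..<n}))
     borel ((\<lambda>f. h (f n)) \<circ> (\<lambda>\<omega>. restrict (\<lambda>i. tau i \<omega>) {n}))"
    using g by (intro indep_var_compose)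
  then show ?thesis unfolding Y by (simp add: o_def)
qed

lemma expectation_tau:
  assumes "h \<in> borel_measurable borel"
  shows "expectation (\<lambda>\<omega>. h (tau i \<omega>) :: real) = expectation (\<lambda>\<omega>. h (tau 0 \<omega>))"
proof -
  have "expectation (\<lambda>\<omega>. h (tau i \<omega>)) = integral\<^sup>L (distr M borel (tau i)) h"
    using assms by (subst integral_distr) auto
  also have "\<dots> = expectation (\<lambda>\<omega>. h (tau 0 \<omega>))"
    unfolding tau_ident[of i] using assms by (subst integral_distr) auto
  finally show ?thesis .
qed

lemma AE_tau:
  assumes [measurable]: "Measurable.pred borel P" and "AE \<omega> in M. P (tau 0 \<omega>)"
  shows "AE \<omega> in M. P (tau i \<omega>)"
proof -
  have "AE x in distr M borel (tau 0). P x"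
    using assms by (subst AE_distr_iff) auto
  then have "AE x in distr M borel (tau i). P x"
    unfolding tau_ident[of i] .
  then show ?thesis
    using assms by (subst (asm) AE_distr_iff) auto
qed

text \<open>Martingale differences are orthogonal; the induction step is Pythagoras.\<close>

lemma second_moment_le:
  assumes h [measurable]: "h \<in> borel_measurable borel" and hB: "\<And>x. \<bar>h x\<bar> \<le> B"
    and w: "\<And>j. adapted j (w j)" and wC: "\<And>j \<omega>. \<bar>w j \<omega>\<bar> \<le> C"
  defines "m \<equiv> expectation (\<lambda>\<omega>. h (tau 0 \<omega>))"
  defines "S \<equiv> \<lambda>n \<omega>. \<Sum>j<n. w j \<omega> * (h (tau j \<omega>) - m)"
  shows "integrable M (\<lambda>\<omega>. (S n \<omega>)\<^sup>2)"
    and "expectation (\<lambda>\<omega>. (S n \<omega>)\<^sup>2) \<le> real n * (C\<^sup>2 * expectation (\<lambda>\<omega>. (h (tau 0 \<omega>))\<^sup>2))"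
proof -
  have w_meas [measurable]: "\<And>j. w j \<in> borel_measurable M"
    using w by (rule adapted_measurable)
  have S_meas [measurable]: "\<And>n. S n \<in> borel_measurable M"
    unfolding S_def by measurable
  define D where "D = (\<lambda>n \<omega>. w n \<omega> * (h (tau n \<omega>) - m))"
  have [measurable]: "\<And>j. D j \<in> borel_measurable M"
    unfolding D_def by measurable
  \<comment> \<open>The bound on \<open>w\<close> at one arbitrary point of the type already forces
    \<open>C\<close> to be nonnegative.\<close>
  have C0: "0 \<le> C" using wC[of 0 undefined] by linarith
  have Db: "\<bar>D j \<omega>\<bar> \<le> C * (B + \<bar>m\<bar>)" for j \<omega>
    unfolding D_def abs_mult using hB[of "tau j \<omega>"] wC[of j \<omega>] C0
    by (intro mult_mono) linarith+
  have Sb: "\<bar>S n \<omega>\<bar> \<le> real n * (C * (B + \<bar>m\<bar>))" for n \<omega>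
  proof -
    have "\<bar>S n \<omega>\<bar> \<le> (\<Sum>j<n. \<bar>D j \<omega>\<bar>)" unfolding S_def D_def by (rule sum_abs)
    also have "\<dots> \<le> (\<Sum>j<n. C * (B + \<bar>m\<bar>))" by (intro sum_mono Db)
    finally show ?thesis by simp
  qed
  have bdd: "integrable M Y" if "Y \<in> borel_measurable M" "\<And>\<omega>. \<bar>Y \<omega>\<bar> \<le> K" for Y :: "'a \<Rightarrow> real" and K
    using that by (intro integrable_const_bound[of _ K]) auto
  have intD2: "integrable M (\<lambda>\<omega>. (D n \<omega>)\<^sup>2)" for n
    using Db[of n] by (intro bdd[of _ "(C * (B + \<bar>m\<bar>))\<^sup>2"]) (auto intro!: sq_le_of_abs_le)
  show intS2: "integrable M (\<lambda>\<omega>. (S n \<omega>)\<^sup>2)" for n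
    using Sb[of n] by (intro bdd[of _ "(real n * (C * (B + \<bar>m\<bar>)))\<^sup>2"]) (auto intro!: sq_le_of_abs_le)
  have inth: "integrable M (\<lambda>\<omega>. h (tau j \<omega>))" for j
    using hB by (intro bdd[of _ B]) auto
  have inth2: "integrable M (\<lambda>\<omega>. (h (tau j \<omega>))\<^sup>2)" for j
    using hB by (intro bdd[of _ "B\<^sup>2"]) (auto intro!: sq_le_of_abs_le)
  have Sad: "adapted n (S n)" for n
    unfolding S_def
  proof (rule adapted_sum)
    fix j assume "j \<in> {..<n}"
    then show "adapted n (\<lambda>\<omega>. w j \<omega> * (h (tau j \<omega>) - m))"
      by (intro adapted_mult adapted_mono[OF w] adapted_tau[where h = "\<lambda>x. h x - m"]) auto
  qed
  have intSw: "integrable M (\<lambda>\<omega>. S n \<omega> * w n \<omega>)" for n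
    by (intro bdd[of _ "(real n * (C * (B + \<bar>m\<bar>))) * C"])
       (auto simp: abs_mult intro!: mult_mono Sb wC order_trans[OF _ Sb])
  have cross: "expectation (\<lambda>\<omega>. S n \<omega> * D n \<omega>) = 0" "integrable M (\<lambda>\<omega>. S n \<omega> * D n \<omega>)" for n
  proof -
    \<comment> \<open>Both \<open>S n\<close> and \<open>w n\<close> look only at times before index
      \<open>n\<close>, so their product is independent of the centred factor, whose mean is
      0.\<close>
    have ind: "indep_var borel (\<lambda>\<omega>. S n \<omega> * w n \<omega>) borel (\<lambda>\<omega>. h (tau n \<omega>) - m)"
      by (rule indep_adapted[where h = "\<lambda>x. h x - m"]) (auto intro: adapted_mult Sad w)
    have int: "integrable M (\<lambda>\<omega>. h (tau n \<omega>) - m)" using inth by auto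
    have "expectation (\<lambda>\<omega>. h (tau n \<omega>) - m) = 0"
      using inth[of n] expectation_tau[OF h, of n] by (simp add: m_def prob_space)
    then show "expectation (\<lambda>\<omega>. S n \<omega> * D n \<omega>) = 0"
      using indep_var_lebesgue_integral[OF ind intSw int] by (simp add: D_def mult_ac)
    show "integrable M (\<lambda>\<omega>. S n \<omega> * D n \<omega>)"
      using indep_var_integrable[OF ind intSw int] by (simp add: D_def mult_ac)
  qed
  have var: "expectation (\<lambda>\<omega>. (D n \<omega>)\<^sup>2) \<le> C\<^sup>2 * expectation (\<lambda>\<omega>. (h (tau 0 \<omega>))\<^sup>2)" for n
  proof -
    have "expectation (\<lambda>\<omega>. (D n \<omega>)\<^sup>2) \<le> expectation (\<lambda>\<omega>. C\<^sup>2 * (h (tau n \<omega>) - m)\<^sup>2)"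
    proof (rule integral_mono[OF intD2])
      show "integrable M (\<lambda>\<omega>. C\<^sup>2 * (h (tau n \<omega>) - m)\<^sup>2)"
        using inth inth2 by (auto simp: power2_diff)
      show "(D n \<omega>)\<^sup>2 \<le> C\<^sup>2 * (h (tau n \<omega>) - m)\<^sup>2" for \<omega>
        unfolding D_def power_mult_distrib using wC[of n \<omega>] C0
        by (intro mult_right_mono) (auto intro!: sq_le_of_abs_le)
    qed
    also have "\<dots> = C\<^sup>2 * (expectation (\<lambda>\<omega>. (h (tau n \<omega>))\<^sup>2) - m\<^sup>2)"
    proof -
      have "expectation (\<lambda>\<omega>. (h (tau n \<omega>) - m)\<^sup>2)
          = expectation (\<lambda>\<omega>. (h (tau n \<omega>))\<^sup>2 - 2 * m * h (tau n \<omega>) + m\<^sup>2)"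
        by (intro Bochner_Integration.integral_cong) (auto simp: power2_diff)
      also have "\<dots> = expectation (\<lambda>\<omega>. (h (tau n \<omega>))\<^sup>2) - 2 * m * m + m\<^sup>2"
        using inth[of n] inth2[of n] expectation_tau[OF h, of n] by (simp add: prob_space m_def)
      finally show ?thesis by (simp add: power2_eq_square)
    qed
    \<comment> \<open>Dropping \<open>m\<^sup>2\<close> replaces the variance by the raw second
      moment, the form in which the dyadic truncation can be summed.\<close>
    also have "\<dots> \<le> C\<^sup>2 * expectation (\<lambda>\<omega>. (h (tau n \<omega>))\<^sup>2)"
      by (intro mult_left_mono) auto
    also have "expectation (\<lambda>\<omega>. (h (tau n \<omega>))\<^sup>2) = expectation (\<lambda>\<omega>. (h (tau 0 \<omega>))\<^sup>2)"
      by (rule expectation_tau[where h = "\<lambda>x. (h x)\<^sup>2"]) measurable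
    finally show ?thesis .
  qed
  show "expectation (\<lambda>\<omega>. (S n \<omega>)\<^sup>2) \<le> real n * (C\<^sup>2 * expectation (\<lambda>\<omega>. (h (tau 0 \<omega>))\<^sup>2))"
  proof (induction n)
    case 0
    then show ?case by (simp add: S_def)
  next
    case (Suc n)
    have "(S (Suc n) \<omega>)\<^sup>2 = (S n \<omega>)\<^sup>2 + 2 * (S n \<omega> * D n \<omega>) + (D n \<omega>)\<^sup>2" for \<omega>
      by (simp add: S_def D_def power2_sum)
    then have "expectation (\<lambda>\<omega>. (S (Suc n) \<omega>)\<^sup>2)
        = expectation (\<lambda>\<omega>. (S n \<omega>)\<^sup>2) + expectation (\<lambda>\<omega>. (D n \<omega>)\<^sup>2)"
      using intS2[of n] intD2[of n] cross[of n] by simp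
    then show ?case using Suc var[of n] by (simp add: algebra_simps)
  qed
qed

end

section \<open>The strong law for bounded functions, by way of the square indices\<close>

lemma tendsto_div_of_squares:
  fixes S :: "nat \<Rightarrow> real"
  assumes sq: "(\<lambda>k. S (k\<^sup>2) / real (k\<^sup>2)) \<longlonglongrightarrow> 0" and step: "\<And>n. \<bar>S (Suc n) - S n\<bar> \<le> B"
  shows "(\<lambda>n. S n / real n) \<longlonglongrightarrow> 0"
proof -
  define k where "k = (\<lambda>n. floor_sqrt n)"
  have k: "(k n)\<^sup>2 \<le> n" "n \<le> (k n)\<^sup>2 + 2 * k n" for n
    using floor_sqrt_power2_le[of n] Suc_floor_sqrt_power2_gt[of n]
    by (auto simp: k_def power2_eq_square)
  have klim: "filterlim k at_top sequentially"
    unfolding filterlim_at_top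
  proof
    fix Z
    have "Z \<le> k n" if "Z\<^sup>2 \<le> n" for n
      unfolding k_def using that le_floor_sqrt_iff by blast
    then show "\<forall>\<^sub>F n in sequentially. Z \<le> k n"
      unfolding eventually_sequentially by blast
  qed
  have B0: "0 \<le> B" using step[of 0] by linarith
  have diff: "\<bar>S (m + d) - S m\<bar> \<le> real d * B" for m d
  proof (induction d)
    case (Suc d)
    then show ?case using step[of "m + d"] by (simp add: algebra_simps)
  qed simp
  \<comment> \<open>With \<open>k n\<close> the integer square root, at most \<open>2 * k n\<close>
    steps separate \<open>n\<close> from the square below it. They change \<open>S\<close> by at
    most \<open>2 * k n * B\<close>, which is small against \<open>(k n)\<^sup>2\<close>.\<close>
  have bound: "\<bar>S n / real n\<bar> \<le> \<bar>S ((k n)\<^sup>2) / real ((k n)\<^sup>2)\<bar> + 2 * B * inverse (real (k n))"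
    if "0 < k n" for n
  proof -
    let ?q = "(k n)\<^sup>2"
    have n: "0 < ?q" "?q \<le> n" "n - ?q \<le> 2 * k n" using k[of n] that by auto
    have "\<bar>S n - S ?q\<bar> \<le> real (n - ?q) * B"
      using diff[of ?q "n - ?q"] n by simp
    also have "\<dots> \<le> real (2 * k n) * B"
      using n B0 by (intro mult_right_mono) linarith+
    finally have "\<bar>S n\<bar> \<le> \<bar>S ?q\<bar> + 2 * real (k n) * B" by simp
    then have "\<bar>S n\<bar> / real n \<le> (\<bar>S ?q\<bar> + 2 * real (k n) * B) / real ?q"
      using n B0 by (intro frac_le) (auto simp del: of_nat_power)
    also have "\<dots> = \<bar>S ?q / real ?q\<bar> + 2 * B * inverse (real (k n))"
      using that by (simp add: field_simps power2_eq_square)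
    finally show ?thesis by simp
  qed
  define g where "g = (\<lambda>j. \<bar>S (j\<^sup>2) / real (j\<^sup>2)\<bar> + 2 * B * inverse (real j))"
  have "g \<longlonglongrightarrow> \<bar>0\<bar> + 2 * B * 0"
    unfolding g_def by (intro tendsto_intros sq lim_inverse_n)
  from filterlim_compose[OF this klim] have glim: "(\<lambda>n. g (k n)) \<longlonglongrightarrow> 0"
    by simp
  have "\<forall>\<^sub>F n in sequentially. 1 \<le> k n"
    using klim unfolding filterlim_at_top by blast
  then have "\<forall>\<^sub>F n in sequentially. norm (S n / real n) \<le> g (k n)"
  proof eventually_elim
    case (elim n)
    then show ?case using bound[of n] unfolding g_def real_norm_def by linarith
  qed
  then show ?thesis
    using glim by (rule Lim_null_comparison)
qed

context iid_times
begin

text \<open>The mean square of \<open>S n / n\<close> is only of order \<open>1 / n\<close>, which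
  is not summable; along the squares it is of order \<open>1 / k\<^sup>2\<close>, which is. The
  averages therefore vanish along the squares, and the bounded increments fill the gaps.\<close>

lemma slln_bounded:
  assumes h [measurable]: "h \<in> borel_measurable borel" and hB: "\<And>x. \<bar>h x\<bar> \<le> B"
    and w: "\<And>j. adapted j (w j)" and wC: "\<And>j \<omega>. \<bar>w j \<omega>\<bar> \<le> C"
  shows "AE \<omega> in M. (\<lambda>n. (\<Sum>j<n. w j \<omega> * (h (tau j \<omega>) - expectation (\<lambda>\<omega>. h (tau 0 \<omega>)))) / real n) \<longlonglongrightarrow> 0"
proof -
  define m where "m = expectation (\<lambda>\<omega>. h (tau 0 \<omega>))"
  define S where "S = (\<lambda>n \<omega>. \<Sum>j<n. w j \<omega> * (h (tau j \<omega>) - m))"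
  define V where "V = C\<^sup>2 * expectation (\<lambda>\<omega>. (h (tau 0 \<omega>))\<^sup>2)"
  have sm: "integrable M (\<lambda>\<omega>. (S n \<omega>)\<^sup>2)" "expectation (\<lambda>\<omega>. (S n \<omega>)\<^sup>2) \<le> real n * V" for n
    unfolding S_def m_def V_def using second_moment_le[OF h hB w wC, of n] by blast+
  have C0: "0 \<le> C" using wC[of 0 undefined] by linarith
  have V0: "0 \<le> V" unfolding V_def by (intro mult_nonneg_nonneg) auto
  define Q where "Q = (\<lambda>k \<omega>. (S (k\<^sup>2) \<omega> / real (k\<^sup>2))\<^sup>2)"
  have intQ: "integrable M (Q k)" for k
    using sm(1)[of "k\<^sup>2"] by (simp add: Q_def power_divide)
  have EQ: "expectation (Q k) \<le> V * inverse (real k ^ 2)" for k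
  proof (cases "k = 0")
    case False
    have "expectation (Q k) = expectation (\<lambda>\<omega>. (S (k\<^sup>2) \<omega>)\<^sup>2) / (real (k\<^sup>2))\<^sup>2"
      by (simp add: Q_def power_divide)
    also have "\<dots> \<le> (real (k\<^sup>2) * V) / (real (k\<^sup>2))\<^sup>2"
      using sm(2)[of "k\<^sup>2"] by (intro divide_right_mono) auto
    also have "\<dots> = V * inverse (real k ^ 2)"
      using False by (simp add: field_simps power2_eq_square)
    finally show ?thesis .
  qed (simp add: Q_def)
  have "summable (\<lambda>k. expectation (Q k))"
  proof (rule summable_comparison_test')
    show "summable (\<lambda>k. V * inverse (real k ^ 2))"
      by (intro summable_mult inverse_power_summable) auto
    show "norm (expectation (Q k)) \<le> V * inverse (real k ^ 2)" if "k \<ge> 0" for k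
      using EQ[of k] by (auto simp: Q_def abs_le_iff intro: order_trans[OF _ EQ])
  qed
  then have "AE \<omega> in M. (\<lambda>k. Q k \<omega>) \<longlonglongrightarrow> 0"
    using intQ by (intro AE_tendsto_zero_of_summable_integrals) (auto simp: Q_def)
  then show ?thesis
  proof eventually_elim
    case (elim \<omega>)
    then have "(\<lambda>k. sqrt (Q k \<omega>)) \<longlonglongrightarrow> 0"
      using tendsto_real_sqrt by fastforce
    then have "(\<lambda>k. S (k\<^sup>2) \<omega> / real (k\<^sup>2)) \<longlonglongrightarrow> 0"
      unfolding Q_def real_sqrt_abs by (rule tendsto_rabs_zero_cancel)
    moreover have "\<bar>S (Suc n) \<omega> - S n \<omega>\<bar> \<le> C * (B + \<bar>m\<bar>)" for n
      using hB[of "tau n \<omega>"] wC[of n \<omega>] C0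
      by (auto simp: S_def abs_mult intro!: mult_mono)
    ultimately show ?case
      unfolding S_def m_def by (rule tendsto_div_of_squares)
  qed
qed

end

section \<open>Dyadic truncation and the strong law for integrable functions\<close>

lemma sum_dyadic_truncated_square_le:
  fixes y :: real assumes "0 \<le> y"
  shows "(\<Sum>m<K. (if y \<le> 2 ^ m then y else 0)\<^sup>2 / 2 ^ m) \<le> 2 * y"
proof -
  define a where "a = (\<lambda>m. (if y \<le> 2 ^ m then y else 0)\<^sup>2 / 2 ^ m)"
  define q where "q = (\<lambda>m::nat. y\<^sup>2 / 2 ^ m)"
  have a: "a m = (if y \<le> 2 ^ m then q m else 0)" for m by (simp add: a_def q_def)
  have q: "q m = 2 * q (Suc m)" "0 \<le> q m" for m by (simp_all add: q_def)
  have qy: "q m \<le> y" if "y \<le> 2 ^ m" for m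
  proof -
    have "y * y \<le> y * 2 ^ m" using that assms by (intro mult_left_mono)
    then show ?thesis by (simp add: q_def power2_eq_square pos_divide_le_eq)
  qed
  \<comment> \<open>The terms are 0 until the first \<open>m\<close> with
    \<open>y \<le> 2 ^ m\<close>, where \<open>q m \<le> y\<close>, and halve from there on. The
    tail of the geometric series still missing after index \<open>K\<close> is \<open>q K\<close>;
    subtracting it gives a bound that is stable under induction.\<close>
  have *: "sum a {..<Suc K} \<le> (if y \<le> 2 ^ K then 2 * y - q K else 0)" for K
  proof (induction K)
    case 0
    show ?case using qy[of 0] by (simp add: a)
  next
    case (Suc K)
    have pow: "(2::real) ^ K \<le> 2 ^ Suc K" by simp
    have "sum a {..<Suc (Suc K)} = sum a {..<Suc K} + a (Suc K)" by simp
    then show ?case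
      using Suc pow a[of "Suc K"] q[of K] qy[of "Suc K"] by (smt (verit))
  qed
  have "sum a {..<K} \<le> sum a {..<Suc K}" using q(2)[of K] by (simp add: a)
  also have "\<dots> \<le> 2 * y" using *[of K] q(2)[of K] assms by (smt (verit))
  finally show ?thesis by (simp add: a_def)
qed

lemma sum_dyadic_exceedance_le:
  fixes y :: real assumes "0 \<le> y"
  shows "(\<Sum>m<K. 2 ^ m * (if 2 ^ m < y then 1 else 0)) \<le> 2 * y"
proof -
  \<comment> \<open>The second conjunct carries the induction: when \<open>2 ^ K < y\<close>, the
    earlier terms sum to at most \<open>2 ^ K\<close>, so the new total is at most twice
    \<open>2 ^ K\<close> and hence below \<open>2 * y\<close>.\<close>
  have "(\<Sum>m<K. 2 ^ m * (if 2 ^ m < y then 1 else 0 :: real)) \<le> 2 * y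
     \<and> (\<Sum>m<K. 2 ^ m * (if 2 ^ m < y then 1 else 0 :: real)) \<le> 2 ^ K"
    using assms by (induction K) auto
  then show ?thesis by blast
qed

context iid_times
begin

text \<open>Truncating the summands with index below \<open>2 ^ m\<close> at level \<open>2 ^ m\<close> makes both the variances
  and the probabilities of an exceedance summable over \<open>m\<close>; for nonnegative summands the gaps
  between consecutive powers of 2 cost only a factor 2.\<close>

lemma AE_eventually_sum_le:
  assumes h [measurable]: "h \<in> borel_measurable borel" and h0: "\<And>x. 0 \<le> h x"
    and int: "integrable M (\<lambda>\<omega>. h (tau 0 \<omega>))" and \<delta>: "0 < \<delta>"
  shows "AE \<omega> in M. \<forall>\<^sub>F n in sequentially.
    (\<Sum>j<n. h (tau j \<omega>)) \<le> 2 * real n * (expectation (\<lambda>\<omega>. h (tau 0 \<omega>)) + \<delta>)"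
proof -
  define \<mu> where "\<mu> = expectation (\<lambda>\<omega>. h (tau 0 \<omega>))"
  have mu0: "0 \<le> \<mu>" unfolding \<mu>_def using h0 by simp
  define z where "z = (\<lambda>m x. if h x \<le> 2 ^ m then h x else 0)"
  have z_meas [measurable]: "z m \<in> borel_measurable borel" for m
    unfolding z_def by measurable
  have zb: "\<bar>z m x\<bar> \<le> 2 ^ m" for m x unfolding z_def using h0[of x] by auto
  have zh: "0 \<le> z m x" "z m x \<le> h x" for m x unfolding z_def using h0[of x] by auto
  define e where "e = (\<lambda>m. expectation (\<lambda>\<omega>. z m (tau 0 \<omega>)))"
  have bdd: "integrable M Y" if "Y \<in> borel_measurable M" "\<And>\<omega>. \<bar>Y \<omega>\<bar> \<le> K" for Y :: "'a \<Rightarrow> real" and K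
    using that by (intro integrable_const_bound[of _ K]) auto
  have intz: "integrable M (\<lambda>\<omega>. z m (tau 0 \<omega>))" for m
    using zb by (intro bdd[of _ "2 ^ m"]) auto
  have intz2: "integrable M (\<lambda>\<omega>. (z m (tau 0 \<omega>))\<^sup>2)" for m
    using zb by (intro bdd[of _ "(2 ^ m)\<^sup>2"]) (auto intro!: sq_le_of_abs_le)
  have e_le: "e m \<le> \<mu>" for m
    unfolding e_def \<mu>_def using zh by (intro integral_mono intz int) auto
  define S where "S = (\<lambda>m \<omega>. \<Sum>j<2 ^ m. z m (tau j \<omega>) - e m)"
  have S: "integrable M (\<lambda>\<omega>. (S m \<omega>)\<^sup>2)"
    "expectation (\<lambda>\<omega>. (S m \<omega>)\<^sup>2) \<le> 2 ^ m * expectation (\<lambda>\<omega>. (z m (tau 0 \<omega>))\<^sup>2)" for m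
    using second_moment_le[of "z m" "2 ^ m" "\<lambda>_ _. 1" 1 "2 ^ m"] zb
    by (auto simp: S_def e_def adapted_const)
  define Q where "Q = (\<lambda>m \<omega>. (S m \<omega>)\<^sup>2 / (2 ^ m)\<^sup>2)"
  have intQ: "integrable M (Q m)" for m unfolding Q_def using S(1) by simp
  \<comment> \<open>The second moment of a block of length \<open>2 ^ m\<close>, divided by the
    squared length, leaves the truncated second moment over \<open>2 ^ m\<close>, which is the
    expected summand of \<open>sum_dyadic_truncated_square_le\<close>.\<close>
  have EQ: "expectation (Q m) \<le> expectation (\<lambda>\<omega>. (z m (tau 0 \<omega>))\<^sup>2 / 2 ^ m)" for m
  proof -
    have "expectation (Q m) = expectation (\<lambda>\<omega>. (S m \<omega>)\<^sup>2) / (2 ^ m)\<^sup>2" by (simp add: Q_def)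
    also have "\<dots> \<le> (2 ^ m * expectation (\<lambda>\<omega>. (z m (tau 0 \<omega>))\<^sup>2)) / (2 ^ m)\<^sup>2"
      by (intro divide_right_mono S(2)) simp
    also have "\<dots> = expectation (\<lambda>\<omega>. (z m (tau 0 \<omega>))\<^sup>2) / 2 ^ m"
      by (simp add: power2_eq_square)
    finally show ?thesis by simp
  qed
  have "summable (\<lambda>m. expectation (Q m))"
  proof (rule summableI_nonneg_bounded)
    show "0 \<le> expectation (Q m)" for m by (simp add: Q_def)
    fix K
    have "(\<Sum>m<K. expectation (Q m)) \<le> (\<Sum>m<K. expectation (\<lambda>\<omega>. (z m (tau 0 \<omega>))\<^sup>2 / 2 ^ m))"
      by (intro sum_mono EQ)
    also have "\<dots> = expectation (\<lambda>\<omega>. \<Sum>m<K. (z m (tau 0 \<omega>))\<^sup>2 / 2 ^ m)"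
      using intz2 by (subst Bochner_Integration.integral_sum) auto
    also have "\<dots> \<le> expectation (\<lambda>\<omega>. 2 * h (tau 0 \<omega>))"
      using intz2 int sum_dyadic_truncated_square_le[OF h0]
      by (intro integral_mono) (auto simp: z_def)
    finally show "(\<Sum>m<K. expectation (Q m)) \<le> 2 * \<mu>" by (simp add: \<mu>_def)
  qed
  then have AE_Q: "AE \<omega> in M. (\<lambda>m. Q m \<omega>) \<longlonglongrightarrow> 0"
    using intQ by (intro AE_tendsto_zero_of_summable_integrals) (auto simp: Q_def)
  define ex where "ex = (\<lambda>m x. if 2 ^ m < h x then 1 else 0 :: real)"
  have ex_meas [measurable]: "ex m \<in> borel_measurable borel" for m
    unfolding ex_def by measurable
  \<comment> \<open>The number of indices below \<open>2 ^ m\<close> at which \<open>h\<close>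
    exceeds the truncation level. Its expectation is \<open>2 ^ m\<close> times the probability of a
    single exceedance, and these sum by \<open>sum_dyadic_exceedance_le\<close>.\<close>
  define R where "R = (\<lambda>m \<omega>. \<Sum>j<2 ^ m. ex m (tau j \<omega>))"
  have intex: "integrable M (\<lambda>\<omega>. ex m (tau j \<omega>))" for m j
    by (intro bdd[of _ 1]) (auto simp: ex_def)
  have intR: "integrable M (R m)" for m unfolding R_def using intex by auto
  have ER: "expectation (R m) = expectation (\<lambda>\<omega>. 2 ^ m * ex m (tau 0 \<omega>))" for m
  proof -
    have "expectation (R m) = (\<Sum>j<2 ^ m. expectation (\<lambda>\<omega>. ex m (tau j \<omega>)))"
      unfolding R_def using intex by (subst Bochner_Integration.integral_sum) auto
    also have "\<dots> = (\<Sum>j<(2::nat) ^ m. expectation (\<lambda>\<omega>. ex m (tau 0 \<omega>)))"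
      by (intro sum.cong refl expectation_tau) measurable
    finally show ?thesis by simp
  qed
  have "summable (\<lambda>m. expectation (R m))"
  proof (rule summableI_nonneg_bounded)
    show "0 \<le> expectation (R m)" for m
      unfolding R_def ex_def by (intro integral_nonneg_AE AE_I2 sum_nonneg) auto
    fix K
    have "(\<Sum>m<K. expectation (R m)) = (\<Sum>m<K. expectation (\<lambda>\<omega>. 2 ^ m * ex m (tau 0 \<omega>)))"
      unfolding ER ..
    also have "\<dots> = expectation (\<lambda>\<omega>. \<Sum>m<K. 2 ^ m * ex m (tau 0 \<omega>))"
      using intex by (subst Bochner_Integration.integral_sum) auto
    also have "\<dots> \<le> expectation (\<lambda>\<omega>. 2 * h (tau 0 \<omega>))"
      using intex int sum_dyadic_exceedance_le[OF h0]
      by (intro integral_mono) (auto simp: ex_def)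
    finally show "(\<Sum>m<K. expectation (R m)) \<le> 2 * \<mu>" by (simp add: \<mu>_def)
  qed
  then have AE_R: "AE \<omega> in M. (\<lambda>m. R m \<omega>) \<longlonglongrightarrow> 0"
    using intR by (intro AE_tendsto_zero_of_summable_integrals)
      (auto simp: R_def ex_def intro!: sum_nonneg)
  show ?thesis
    using AE_Q AE_R
  proof eventually_elim
    case (elim \<omega>)
    have "\<forall>\<^sub>F m in sequentially. Q m \<omega> < \<delta>\<^sup>2"
      using elim(1) \<delta> by (intro order_tendstoD(2)) auto
    moreover have "\<forall>\<^sub>F m in sequentially. R m \<omega> < 1"
      using elim(2) by (intro order_tendstoD(2)) auto
    ultimately have "\<forall>\<^sub>F m in sequentially. (\<Sum>j<2 ^ m. h (tau j \<omega>)) \<le> 2 ^ m * (\<mu> + \<delta>)"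
    proof eventually_elim
      case (elim m)
      \<comment> \<open>\<open>R m\<close> is a sum of indicators, so a value below 1 means that no
        exceedance occurs, and truncation then changes nothing in this block.\<close>
      have no: "h (tau j \<omega>) \<le> 2 ^ m" if j: "j < 2 ^ m" for j
      proof (rule ccontr)
        assume "\<not> ?thesis"
        then have "1 = ex m (tau j \<omega>)" by (simp add: ex_def)
        also have "\<dots> \<le> R m \<omega>"
          unfolding R_def using j by (intro member_le_sum) (auto simp: ex_def)
        finally show False using elim by simp
      qed
      have "\<bar>S m \<omega>\<bar>\<^sup>2 < (\<delta> * 2 ^ m)\<^sup>2"
        using elim(1) by (simp add: Q_def divide_less_eq power_mult_distrib)
      then have "\<bar>S m \<omega>\<bar> < \<delta> * 2 ^ m"
        using \<delta> by (intro power2_less_imp_less[of "\<bar>S m \<omega>\<bar>"]) auto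
      moreover have "(\<Sum>j<2 ^ m. h (tau j \<omega>)) = S m \<omega> + 2 ^ m * e m"
        using no by (simp add: S_def z_def sum_subtractf)
      moreover have "2 ^ m * e m \<le> 2 ^ m * \<mu>" using e_le by simp
      ultimately show ?case unfolding distrib_left mult.commute[of \<delta>] by linarith
    qed
    then obtain m0 where m0: "\<And>m. m0 \<le> m \<Longrightarrow> (\<Sum>j<2 ^ m. h (tau j \<omega>)) \<le> 2 ^ m * (\<mu> + \<delta>)"
      unfolding eventually_sequentially by blast
    have "(\<Sum>j<n. h (tau j \<omega>)) \<le> 2 * real n * (\<mu> + \<delta>)" if n: "2 ^ m0 \<le> n" for n
    proof -
      have "1 \<le> n" using n by (meson one_le_numeral one_le_power order_trans)
      then obtain k where k: "2 ^ k \<le> n" "n < 2 ^ (k + 1)"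
        using ex_power_ivl1[of 2 n] by auto
      have "(2::nat) ^ m0 < 2 ^ (k + 1)" using n k by linarith
      then have "m0 \<le> k + 1" using power_less_imp_less_exp[of "2::nat" m0 "k + 1"] by auto
      have "(\<Sum>j<n. h (tau j \<omega>)) \<le> (\<Sum>j<2 ^ (k + 1). h (tau j \<omega>))"
        using k h0 by (intro sum_mono2) auto
      also have "\<dots> \<le> 2 ^ (k + 1) * (\<mu> + \<delta>)" by (rule m0) fact
      also have "\<dots> \<le> 2 * real n * (\<mu> + \<delta>)"
      proof (rule mult_right_mono)
        have "real (2 ^ k) \<le> real n" using k(1) by (rule of_nat_mono)
        then show "2 ^ (k + 1) \<le> 2 * real n" by simp
      qed (use mu0 \<delta> in auto)
      finally show ?thesis .
    qed
    then show ?case unfolding eventually_sequentially \<mu>_def by blast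
  qed
qed

text \<open>The bounded case handles \<open>h\<close> truncated at a fixed level \<open>K\<close>; the remainders have
  small expectation and are controlled by the preceding upper bound.\<close>

theorem slln_martingale_transform:
  assumes h [measurable]: "h \<in> borel_measurable borel"
    and int: "integrable M (\<lambda>\<omega>. h (tau 0 \<omega>))"
    and w: "\<And>j. adapted j (w j)" and wC: "\<And>j \<omega>. \<bar>w j \<omega>\<bar> \<le> C"
  shows "AE \<omega> in M. (\<lambda>n. (\<Sum>j<n. w j \<omega> * (h (tau j \<omega>) - expectation (\<lambda>\<omega>. h (tau 0 \<omega>)))) / real n) \<longlonglongrightarrow> 0"
proof -
  have C0: "0 \<le> C" using wC[of 0 undefined] by linarith
  define \<mu> where "\<mu> = expectation (\<lambda>\<omega>. h (tau 0 \<omega>))"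
  define b where "b = (\<lambda>(K::nat) x. if \<bar>h x\<bar> \<le> real K then h x else 0)"
  \<comment> \<open>The remainder keeps the absolute value of what \<open>b\<close> discards. Being
    nonnegative and integrable, it falls under \<open>AE_eventually_sum_le\<close>, while its
    expectation goes to 0 with \<open>K\<close> by dominated convergence.\<close>
  define r where "r = (\<lambda>(K::nat) x. if \<bar>h x\<bar> \<le> real K then 0 else \<bar>h x\<bar>)"
  have b_meas [measurable]: "b K \<in> borel_measurable borel" for K unfolding b_def by measurable
  have r_meas [measurable]: "r K \<in> borel_measurable borel" for K unfolding r_def by measurable
  have bB: "\<bar>b K x\<bar> \<le> real K" and r0: "0 \<le> r K x" and rh: "r K x \<le> \<bar>h x\<bar>"
    and br: "\<bar>h x - b K x\<bar> \<le> r K x" for K x by (auto simp: b_def r_def)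
  define \<beta> where "\<beta> = (\<lambda>K. expectation (\<lambda>\<omega>. b K (tau 0 \<omega>)))"
  define \<epsilon> where "\<epsilon> = (\<lambda>K. expectation (\<lambda>\<omega>. r K (tau 0 \<omega>)))"
  have intb: "integrable M (\<lambda>\<omega>. b K (tau 0 \<omega>))" for K
    using bB by (intro integrable_const_bound[of _ "real K"]) auto
  have intr: "integrable M (\<lambda>\<omega>. r K (tau 0 \<omega>))" for K
    using rh r0 by (intro Bochner_Integration.integrable_bound[OF int]) auto
  have \<epsilon>0: "0 \<le> \<epsilon> K" for K unfolding \<epsilon>_def using r0 by simp
  have bmu: "\<bar>\<mu> - \<beta> K\<bar> \<le> \<epsilon> K" for K
  proof -
    have "\<mu> - \<beta> K = expectation (\<lambda>\<omega>. h (tau 0 \<omega>) - b K (tau 0 \<omega>))"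
      unfolding \<mu>_def \<beta>_def using int intb by simp
    also have "\<bar>\<dots>\<bar> \<le> expectation (\<lambda>\<omega>. \<bar>h (tau 0 \<omega>) - b K (tau 0 \<omega>)\<bar>)"
      by (rule integral_abs_bound)
    also have "\<dots> \<le> \<epsilon> K"
      unfolding \<epsilon>_def using int intb br intr by (intro integral_mono) auto
    finally show ?thesis .
  qed
  have eps: "\<epsilon> \<longlonglongrightarrow> 0"
  proof -
    have "(\<lambda>K. expectation (\<lambda>\<omega>. r K (tau 0 \<omega>))) \<longlonglongrightarrow> expectation (\<lambda>_. 0)"
    proof (rule integral_dominated_convergence[where w = "\<lambda>\<omega>. \<bar>h (tau 0 \<omega>)\<bar>"])
      show "AE \<omega> in M. (\<lambda>K. r K (tau 0 \<omega>)) \<longlonglongrightarrow> 0"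
      proof (rule AE_I2)
        fix \<omega>
        obtain K0 :: nat where "\<bar>h (tau 0 \<omega>)\<bar> \<le> real K0" using real_arch_simple by blast
        then have "r K (tau 0 \<omega>) = 0" if "K0 \<le> K" for K
          using that by (auto simp: r_def)
        then have "\<forall>\<^sub>F K in sequentially. r K (tau 0 \<omega>) = 0"
          unfolding eventually_sequentially by blast
        then show "(\<lambda>K. r K (tau 0 \<omega>)) \<longlonglongrightarrow> 0" by (rule tendsto_eventually)
      qed
      show "AE \<omega> in M. norm (r K (tau 0 \<omega>)) \<le> \<bar>h (tau 0 \<omega>)\<bar>" for K
        using rh r0 by auto
    qed (use int in auto)
    then show ?thesis by (simp add: \<epsilon>_def)
  qed
  \<comment> \<open>The upper bound for the remainders asks for a positive slack. Letting the slack
    depend on \<open>K\<close> leaves only countably many almost sure events, and it disappears as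
    \<open>K\<close> grows.\<close>
  define d where "d = (\<lambda>K::nat. inverse (real (Suc K)))"
  have d0: "0 < d K" for K by (simp add: d_def)
  have "AE \<omega> in M. \<forall>K. (\<lambda>n. (\<Sum>j<n. w j \<omega> * (b K (tau j \<omega>) - \<beta> K)) / real n) \<longlonglongrightarrow> 0"
    unfolding AE_all_countable \<beta>_def using bB w wC by (intro allI slln_bounded b_meas)
  moreover have "AE \<omega> in M. \<forall>K. \<forall>\<^sub>F n in sequentially.
      (\<Sum>j<n. r K (tau j \<omega>)) \<le> 2 * real n * (\<epsilon> K + d K)"
    unfolding AE_all_countable \<epsilon>_def using r0 intr d0 by (intro allI AE_eventually_sum_le r_meas)
  ultimately show ?thesis
  proof eventually_elim
    case (elim \<omega>)
    have "(\<lambda>n. (\<Sum>j<n. w j \<omega> * (h (tau j \<omega>) - \<mu>)) / real n) \<longlonglongrightarrow> 0"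
    proof (rule LIMSEQ_I)
      fix e :: real assume e: "0 < e"
      \<comment> \<open>The cost of truncation at \<open>K\<close>: the averaged remainders
        contribute \<open>2 * (\<epsilon> K + d K)\<close>, the shift of the mean from \<mu> to
        \<open>\<beta> K\<close> contributes another \<open>\<epsilon> K\<close>, and the weights
        multiply this by at most \<open>C\<close>.\<close>
      have "(\<lambda>K. C * (3 * \<epsilon> K + 2 * d K)) \<longlonglongrightarrow> C * (3 * 0 + 2 * 0)"
        unfolding d_def by (intro tendsto_intros eps LIMSEQ_inverse_real_of_nat)
      then have "\<forall>\<^sub>F K in sequentially. C * (3 * \<epsilon> K + 2 * d K) < e / 2"
        using e by (intro order_tendstoD(2)) auto
      then obtain K where K: "C * (3 * \<epsilon> K + 2 * d K) < e / 2"
        unfolding eventually_sequentially by blast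
      have "\<forall>\<^sub>F n in sequentially. \<bar>(\<Sum>j<n. w j \<omega> * (b K (tau j \<omega>) - \<beta> K)) / real n\<bar> < e / 2"
        using elim(1) e tendstoD[of _ 0 sequentially "e / 2"] by (fastforce simp: dist_real_def)
      moreover have "\<forall>\<^sub>F n in sequentially. 0 < n" by (rule eventually_gt_at_top)
      moreover note elim(2)[rule_format, of K]
      ultimately have "\<forall>\<^sub>F n in sequentially. norm ((\<Sum>j<n. w j \<omega> * (h (tau j \<omega>) - \<mu>)) / real n - 0) < e"
      proof eventually_elim
        case (elim n)
        have split: "w j \<omega> * (h (tau j \<omega>) - \<mu>) = w j \<omega> * (b K (tau j \<omega>) - \<beta> K)
            + w j \<omega> * ((h (tau j \<omega>) - b K (tau j \<omega>)) - (\<mu> - \<beta> K))" for j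
          by (simp add: algebra_simps)
        have "\<bar>\<Sum>j<n. w j \<omega> * ((h (tau j \<omega>) - b K (tau j \<omega>)) - (\<mu> - \<beta> K))\<bar>
            \<le> (\<Sum>j<n. C * (r K (tau j \<omega>) + \<epsilon> K))"
        proof (rule order_trans[OF sum_abs sum_mono])
          fix j
          show "\<bar>w j \<omega> * ((h (tau j \<omega>) - b K (tau j \<omega>)) - (\<mu> - \<beta> K))\<bar> \<le> C * (r K (tau j \<omega>) + \<epsilon> K)"
            unfolding abs_mult using wC[of j \<omega>] br[of "tau j \<omega>" K] bmu[of K] C0
            by (intro mult_mono) linarith+
        qed
        also have "\<dots> = C * ((\<Sum>j<n. r K (tau j \<omega>)) + real n * \<epsilon> K)"
          by (simp add: sum_distrib_left[symmetric] sum.distrib)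
        also have "\<dots> \<le> C * (2 * real n * (\<epsilon> K + d K) + real n * \<epsilon> K)"
          using elim C0 by (intro mult_left_mono add_right_mono)
        also have "\<dots> = (C * (3 * \<epsilon> K + 2 * d K)) * real n" by (simp add: algebra_simps)
        finally have le: "\<bar>\<Sum>j<n. w j \<omega> * ((h (tau j \<omega>) - b K (tau j \<omega>)) - (\<mu> - \<beta> K))\<bar>
            \<le> (C * (3 * \<epsilon> K + 2 * d K)) * real n" .
        have "\<bar>\<Sum>j<n. w j \<omega> * ((h (tau j \<omega>) - b K (tau j \<omega>)) - (\<mu> - \<beta> K))\<bar> / real n \<le> e / 2"
        proof -
          have "(C * (3 * \<epsilon> K + 2 * d K)) * real n \<le> e / 2 * real n"
            using K by (intro mult_right_mono) auto
          with le show ?thesis using elim(2) by (simp only: pos_divide_le_eq of_nat_0_less_iff)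
        qed
        then have "\<bar>(\<Sum>j<n. w j \<omega> * ((h (tau j \<omega>) - b K (tau j \<omega>)) - (\<mu> - \<beta> K))) / real n\<bar> \<le> e / 2"
          by simp
        then show ?case
          using elim unfolding split sum.distrib add_divide_distrib by (simp only: real_norm_def)
      qed
      then show "\<exists>no. \<forall>n\<ge>no. norm ((\<Sum>j<n. w j \<omega> * (h (tau j \<omega>) - \<mu>)) / real n - 0) < e"
        unfolding eventually_sequentially .
    qed
    then show ?case unfolding \<mu>_def .
  qed
qed

end

section \<open>Random switching between isometries\<close>

text \<open>Up to the last switch before \<open>s\<close> the integral is known to be small. The
  unfinished interval adds at most \<open>C\<close> times its full length, which is negligible
  because the switching times grow linearly.\<close>

lemma time_average_tendsto_zero:
  fixes y :: "real \<Rightarrow> 'e::euclidean_space" and t :: "nat \<Rightarrow> real"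
  assumes t0: "t 0 = 0" and mono: "strict_mono t" and lim: "(\<lambda>n. t n / real n) \<longlonglongrightarrow> \<mu>" and \<mu>: "0 < \<mu>"
    and int: "\<And>n. y integrable_on {0..t n}" and bnd: "\<And>n s. t n \<le> s \<Longrightarrow> s < t (Suc n) \<Longrightarrow> norm (y s) \<le> C"
    and avg: "(\<lambda>n. (1 / real n) *\<^sub>R integral {0..t n} y) \<longlonglongrightarrow> 0"
  shows "y integrable_on {0..s}"
    and "((\<lambda>s. (1 / s) *\<^sub>R integral {0..s} y) \<longlongrightarrow> 0) at_top"
proof -
  have t_top: "filterlim t at_top sequentially"
  proof -
    have "filterlim (\<lambda>n. (t n / real n) * real n) at_top sequentially"
      using lim \<mu> filterlim_real_sequentially by (rule filterlim_tendsto_pos_mult_at_top)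
    moreover have "(t n / real n) * real n = t n" for n using t0 by (cases "n = 0") auto
    ultimately show ?thesis by simp
  qed
  \<comment> \<open>The number of the interval containing \<open>s\<close>:
    \<open>t (N s) \<le> s < t (Suc (N s))\<close> for nonnegative \<open>s\<close>.\<close>
  define N where "N = (\<lambda>s. LEAST n. s < t (Suc n))"
  have ex: "\<exists>n. s < t (Suc n)" for s
  proof -
    have "\<forall>\<^sub>F n in sequentially. s < t n"
      using t_top unfolding filterlim_at_top_dense by blast
    then obtain n where "s < t n" unfolding eventually_sequentially by blast
    also have "t n < t (Suc n)" using mono by (simp add: strict_mono_def)
    finally show ?thesis by blast
  qed
  have N2: "s < t (Suc (N s))" for s
    unfolding N_def by (rule LeastI_ex[OF ex])
  have N1: "t (N s) \<le> s" if "0 \<le> s" for s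
  proof (cases "N s")
    case (Suc m)
    then have "m < (LEAST n. s < t (Suc n))" unfolding N_def by simp
    from not_less_Least[OF this] have "\<not> s < t (Suc m)" .
    then show ?thesis using Suc by simp
  qed (use that t0 in simp)
  have bound: "norm (y s) \<le> C" if "0 \<le> s" for s
    using N1[OF that] N2 by (rule bnd)
  show int_s: "y integrable_on {0..s}" for s
    by (rule integrable_on_subinterval[OF int[of "Suc (N s)"]]) (use N2[of s] in auto)
  have N_top: "filterlim N at_top at_top"
    unfolding filterlim_at_top
  proof
    fix m
    have "m \<le> N s" if "t m \<le> s" for s
    proof (rule ccontr)
      assume "\<not> m \<le> N s"
      then have "t (Suc (N s)) \<le> t m" using mono by (simp add: strict_mono_less_eq)
      then show False using N2[of s] that by linarith
    qed
    then show "\<forall>\<^sub>F s in at_top. m \<le> N s"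
      unfolding eventually_at_top_linorder by blast
  qed
  \<comment> \<open>A bound for the average at any time in interval \<open>n\<close>: the full next
    interval is charged and the divisor is rounded down to \<open>t n\<close>. Dividing numerator
    and denominator by \<open>n\<close> shows that it tends to 0.\<close>
  define g where "g = (\<lambda>n. (norm (integral {0..t n} y) + C * (t (Suc n) - t n)) / t n)"
  \<comment> \<open>Convergence of \<open>t n / real n\<close> makes single intervals sublinear:
    \<open>t (Suc n) / real n\<close> has the same limit \<mu>, since \<open>Suc n\<close> and
    \<open>n\<close> are asymptotically equal.\<close>
  have gap: "(\<lambda>n. (t (Suc n) - t n) / real n) \<longlonglongrightarrow> 0"
  proof -
    have "(\<lambda>n. (t (Suc n) / real (Suc n)) * (1 + inverse (real n)) - t n / real n) \<longlonglongrightarrow> \<mu> * (1 + 0) - \<mu>"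
      by (intro tendsto_intros lim LIMSEQ_Suc[OF lim] lim_inverse_n)
    then have "(\<lambda>n. (t (Suc n) / real (Suc n)) * (1 + inverse (real n)) - t n / real n) \<longlonglongrightarrow> 0" by simp
    moreover have "\<forall>\<^sub>F n in sequentially.
        (t (Suc n) / real (Suc n)) * (1 + inverse (real n)) - t n / real n = (t (Suc n) - t n) / real n"
      using eventually_gt_at_top[of 0]
    proof eventually_elim
      case (elim n)
      then have "1 + inverse (real n) = real (Suc n) / real n" by (simp add: field_simps)
      then show ?case by (simp add: diff_divide_distrib)
    qed
    ultimately show ?thesis by (rule Lim_transform_eventually)
  qed
  have "(\<lambda>n. (norm ((1 / real n) *\<^sub>R integral {0..t n} y) + C * ((t (Suc n) - t n) / real n)) / (t n / real n))
      \<longlonglongrightarrow> (norm (0::'e) + C * 0) / \<mu>"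
    using \<mu> by (intro tendsto_intros avg gap lim) auto
  then have "(\<lambda>n. (norm ((1 / real n) *\<^sub>R integral {0..t n} y) + C * ((t (Suc n) - t n) / real n)) / (t n / real n)) \<longlonglongrightarrow> 0"
    by simp
  moreover have "\<forall>\<^sub>F n in sequentially.
      (norm ((1 / real n) *\<^sub>R integral {0..t n} y) + C * ((t (Suc n) - t n) / real n)) / (t n / real n) = g n"
    using eventually_gt_at_top[of 0]
  proof eventually_elim
    case (elim n)
    have "norm ((1 / real n) *\<^sub>R integral {0..t n} y) + C * ((t (Suc n) - t n) / real n)
        = (norm (integral {0..t n} y) + C * (t (Suc n) - t n)) / real n"
      by (simp add: add_divide_distrib)
    then show ?case unfolding g_def using elim by simp
  qed
  ultimately have "g \<longlonglongrightarrow> 0" by (rule Lim_transform_eventually)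
  then have glim: "((\<lambda>s. g (N s)) \<longlongrightarrow> 0) at_top"
    by (rule filterlim_compose[OF _ N_top])
  have "\<forall>\<^sub>F s in at_top. 1 \<le> N s" using N_top unfolding filterlim_at_top by blast
  moreover have "\<forall>\<^sub>F s in at_top. (0::real) < s" by (rule eventually_gt_at_top)
  ultimately have "\<forall>\<^sub>F s in at_top. norm ((1 / s) *\<^sub>R integral {0..s} y) \<le> g (N s)"
  proof eventually_elim
    case (elim s)
    let ?n = "N s"
    have tn: "0 < t ?n" using elim mono t0 by (metis One_nat_def Suc_le_lessD strict_mono_less)
    have le: "t ?n \<le> s" "s < t (Suc ?n)" using N1[of s] N2[of s] elim by auto
    have int_s': "y integrable_on {t ?n..s}"
      by (rule integrable_on_subinterval[OF int_s[of s]]) (use tn in auto)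
    have "norm (integral {t ?n..s} y) \<le> C * (s - t ?n)"
      using has_integral_bound_real[of C "{}" y "integral {t ?n..s} y" "t ?n" s]
        order_trans[OF norm_ge_zero bound[of 0]] integrable_integral[OF int_s'] bound tn le
      by simp
    also have "\<dots> \<le> C * (t (Suc ?n) - t ?n)"
      using le order_trans[OF norm_ge_zero bound[of 0]] by (intro mult_left_mono) auto
    finally have *: "norm (integral {t ?n..s} y) \<le> C * (t (Suc ?n) - t ?n)" .
    have "integral {0..s} y = integral {0..t ?n} y + integral {t ?n..s} y"
      using Henstock_Kurzweil_Integration.integral_combine[OF _ le(1) int_s[of s]] tn by simp
    then have "norm (integral {0..s} y) \<le> norm (integral {0..t ?n} y) + C * (t (Suc ?n) - t ?n)"
      using * norm_triangle_ineq[of "integral {0..t ?n} y" "integral {t ?n..s} y"] by simp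
    then have "norm (integral {0..s} y) / s \<le> g ?n"
      unfolding g_def using tn le elim by (intro frac_le) (auto intro: order_trans[OF norm_ge_zero])
    then show ?case using elim by simp
  qed
  then show "((\<lambda>s. (1 / s) *\<^sub>R integral {0..s} y) \<longlongrightarrow> 0) at_top"
    using glim by (rule Lim_null_comparison)
qed

text \<open>The Euclidean space stands for the complex matrices and \<open>T\<close> for conjugation
  by the two evolutions, with \<open>True\<close> for the one that acts first. Controllability and
  the vanishing trace of the start enter through the last assumption: the start is orthogonal to
  every vector that both families fix.\<close>

locale isometric_switching = iid_times M tau for M :: "'a measure" and tau +
  fixes T :: "bool \<Rightarrow> real \<Rightarrow> 'e::euclidean_space \<Rightarrow> 'e" and x0 :: 'e and f :: "real \<Rightarrow> ennreal"
  assumes T_linear: "\<And>p s. linear (T p s)"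
    and T_norm: "\<And>p s v. norm (T p s v) = norm v"
    and T_cont: "\<And>p v. continuous_on UNIV (\<lambda>s. T p s v)"
    and T_0: "\<And>p v. T p 0 v = v"
    and tau_pos: "AE \<omega> in M. 0 < tau 0 \<omega>"
    and tau_int: "integrable M (tau 0)"
    and tau_density: "distributed M lborel (tau 0) f"
    and density_pos: "\<And>s. 0 \<le> s \<Longrightarrow> 0 < f s"
    and x0_orth: "\<And>v. (\<And>p s. 0 \<le> s \<Longrightarrow> T p s v = v) \<Longrightarrow> x0 \<bullet> v = 0"
begin

text \<open>The state at \<open>switch_time tau \<omega> j\<close>. Intervals are numbered from 0,
  so the interval of length \<open>tau j \<omega>\<close> starts here and \<open>True\<close>
  belongs to the even numbers.\<close>

primrec orb :: "'a \<Rightarrow> nat \<Rightarrow> 'e" where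
  "orb \<omega> 0 = x0"
| "orb \<omega> (Suc j) = T (even j) (tau j \<omega>) (orb \<omega> j)"

lemma norm_orb: "norm (orb \<omega> j) = norm x0"
  by (induction j) (auto simp: T_norm)

lemma T_measurable [measurable]: "(\<lambda>s. T p s v) \<in> borel_measurable borel"
  using T_cont by (rule borel_measurable_continuous_onI)

text \<open>This separates past from present: for a random map driven by \<open>tau j\<close>, each
  summand is a coordinate of the current state times a function of the single new time, as a
  martingale transform requires.\<close>

lemma linear_component_expand:
  fixes L :: "'e \<Rightarrow> 'e" assumes "linear L"
  shows "L v \<bullet> b = (\<Sum>b'\<in>Basis. (v \<bullet> b') * (L b' \<bullet> b))"
proof -
  have "L v = L (\<Sum>b'\<in>Basis. (v \<bullet> b') *\<^sub>R b')" by (simp add: euclidean_representation)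
  also have "\<dots> = (\<Sum>b'\<in>Basis. (v \<bullet> b') *\<^sub>R L b')"
    using assms by (simp add: linear_sum linear_scale)
  finally show ?thesis by (simp add: inner_sum_left)
qed

lemma adapted_orb: "adapted j (\<lambda>\<omega>. orb \<omega> j \<bullet> b)"
proof (induction j arbitrary: b)
  case 0
  show ?case by (simp add: adapted_const)
next
  case (Suc j)
  have "adapted (Suc j) (\<lambda>\<omega>. \<Sum>b'\<in>Basis. (orb \<omega> j \<bullet> b') * (T (even j) (tau j \<omega>) b' \<bullet> b))"
    by (intro adapted_sum adapted_mult adapted_mono[OF Suc]
        adapted_tau[where h = "\<lambda>s. T (even j) s b' \<bullet> b" for b']) auto
  then show ?case by (simp add: linear_component_expand[OF T_linear, symmetric])
qed

text \<open>In coordinates the claim splits into finitely many martingale transforms, one for each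
  pair of basis vectors, whose weights are coordinates of the orbit switched off at the wrong
  parity. \<open>K\<close> will be \<open>T\<close> itself and also its integral over an interval;
  the latter is integrable but not bounded.\<close>

lemma slln_orbit:
  fixes K :: "real \<Rightarrow> 'e \<Rightarrow> 'e"
  assumes lin: "\<And>s. linear (K s)" and meas: "\<And>v. (\<lambda>s. K s v) \<in> borel_measurable borel"
    and int: "\<And>v. integrable M (\<lambda>\<omega>. K (tau 0 \<omega>) v)"
  shows "AE \<omega> in M. (\<lambda>n. (1 / real n) *\<^sub>R (\<Sum>j<n. if even j = p
     then K (tau j \<omega>) (orb \<omega> j) - (\<integral>\<omega>'. K (tau 0 \<omega>') (orb \<omega> j) \<partial>M) else 0)) \<longlonglongrightarrow> 0"
proof -
  note meas [measurable]
  define m where "m = (\<lambda>b' b. expectation (\<lambda>\<omega>. K (tau 0 \<omega>) b' \<bullet> b))"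
  define w where "w = (\<lambda>b' j \<omega>. (if even j = p then 1 else 0) * (orb \<omega> j \<bullet> b'))"
  have "AE \<omega> in M. (\<lambda>n. (\<Sum>j<n. w b' j \<omega> * (K (tau j \<omega>) b' \<bullet> b - m b' b)) / real n) \<longlonglongrightarrow> 0"
    if "b' \<in> Basis" for b' b
    unfolding m_def
  proof (rule slln_martingale_transform[where h = "\<lambda>s. K s b' \<bullet> b" and C = "norm x0"])
    show "adapted j (w b' j)" for j
      unfolding w_def by (intro adapted_mult adapted_const adapted_orb)
    show "\<bar>w b' j \<omega>\<bar> \<le> norm x0" for j \<omega>
      using Basis_le_norm[OF that, of "orb \<omega> j"] by (auto simp: w_def norm_orb)
    show "integrable M (\<lambda>\<omega>. K (tau 0 \<omega>) b' \<bullet> b)" using int by simp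
  qed measurable
  then have "AE \<omega> in M. \<forall>b'\<in>Basis. \<forall>b\<in>Basis.
      (\<lambda>n. (\<Sum>j<n. w b' j \<omega> * (K (tau j \<omega>) b' \<bullet> b - m b' b)) / real n) \<longlonglongrightarrow> 0"
    by (intro AE_finite_allI) auto
  then show ?thesis
  proof eventually_elim
    case (elim \<omega>)
    let ?E = "\<lambda>v. (\<integral>\<omega>'. K (tau 0 \<omega>') v \<partial>M)"
    \<comment> \<open>The expected map has the matrix entries \<open>m b' b\<close>, the constants
      by which the scalar transforms are centred.\<close>
    have E: "?E v \<bullet> b = (\<Sum>b'\<in>Basis. (v \<bullet> b') * m b' b)" for v b
    proof -
      have "?E v \<bullet> b = (\<integral>\<omega>'. K (tau 0 \<omega>') v \<bullet> b \<partial>M)"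
        using int by simp
      also have "\<dots> = (\<integral>\<omega>'. (\<Sum>b'\<in>Basis. (v \<bullet> b') * (K (tau 0 \<omega>') b' \<bullet> b)) \<partial>M)"
        by (subst linear_component_expand[OF lin]) simp
      also have "\<dots> = (\<Sum>b'\<in>Basis. (v \<bullet> b') * m b' b)"
        unfolding m_def using int by (subst Bochner_Integration.integral_sum) auto
      finally show ?thesis .
    qed
    show ?case
      unfolding tendsto_componentwise_iff[of _ 0]
    proof
      fix b :: 'e assume b: "b \<in> Basis"
      have "(\<lambda>n. \<Sum>b'\<in>Basis. (\<Sum>j<n. w b' j \<omega> * (K (tau j \<omega>) b' \<bullet> b - m b' b)) / real n) \<longlonglongrightarrow> (\<Sum>b'\<in>(Basis::'e set). 0)"
        using elim b by (intro tendsto_sum) auto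
      moreover have "((1 / real n) *\<^sub>R (\<Sum>j<n. if even j = p
          then K (tau j \<omega>) (orb \<omega> j) - ?E (orb \<omega> j) else 0)) \<bullet> b
          = (\<Sum>b'\<in>Basis. (\<Sum>j<n. w b' j \<omega> * (K (tau j \<omega>) b' \<bullet> b - m b' b)) / real n)" for n
      proof -
        have "(if even j = p then K (tau j \<omega>) (orb \<omega> j) - ?E (orb \<omega> j) else 0) \<bullet> b
            = (\<Sum>b'\<in>Basis. w b' j \<omega> * (K (tau j \<omega>) b' \<bullet> b - m b' b))" for j
          by (simp add: w_def inner_diff_left E linear_component_expand[OF lin, of "tau j \<omega>" "orb \<omega> j" b]
              sum_subtractf right_diff_distrib)
        then have "(\<Sum>j<n. if even j = p then K (tau j \<omega>) (orb \<omega> j) - ?E (orb \<omega> j) else 0) \<bullet> b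
            = (\<Sum>b'\<in>Basis. \<Sum>j<n. w b' j \<omega> * (K (tau j \<omega>) b' \<bullet> b - m b' b))"
          by (simp only: inner_sum_left) (rule sum.swap)
        then show ?thesis by (simp add: sum_divide_distrib)
      qed
      ultimately show "(\<lambda>n. ((1 / real n) *\<^sub>R (\<Sum>j<n. if even j = p
          then K (tau j \<omega>) (orb \<omega> j) - ?E (orb \<omega> j) else 0)) \<bullet> b) \<longlonglongrightarrow> 0 \<bullet> b"
        by simp
    qed
  qed
qed

section \<open>The averaged maps and their common fixed vectors\<close>

definition \<Phi> :: "bool \<Rightarrow> 'e \<Rightarrow> 'e" where
  "\<Phi> p v = (\<integral>\<omega>. T p (tau 0 \<omega>) v \<partial>M)"

lemma integrable_T: "integrable M (\<lambda>\<omega>. T p (tau 0 \<omega>) v)"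
  by (rule integrable_const_bound[of _ "norm v"]) (auto simp: T_norm)

lemma bounded_linear_expectation:
  fixes K :: "real \<Rightarrow> 'e \<Rightarrow> 'e"
  assumes lin: "\<And>s. linear (K s)" and int: "\<And>v. integrable M (\<lambda>\<omega>. K (tau 0 \<omega>) v)"
  shows "bounded_linear (\<lambda>v. \<integral>\<omega>. K (tau 0 \<omega>) v \<partial>M)"
  unfolding linear_conv_bounded_linear[symmetric]
  using int by (intro linearI) (simp_all add: linear_add[OF lin] linear_scale[OF lin])

lemma bounded_linear_\<Phi>: "bounded_linear (\<Phi> p)"
  unfolding \<Phi>_def[abs_def] by (rule bounded_linear_expectation[OF T_linear integrable_T])

lemma norm_\<Phi>_le: "norm (\<Phi> p v) \<le> norm v"
proof -
  have "norm (\<Phi> p v) \<le> (\<integral>\<omega>. norm (T p (tau 0 \<omega>) v) \<partial>M)"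
    unfolding \<Phi>_def by (rule integral_norm_bound)
  then show ?thesis by (simp add: T_norm prob_space)
qed

text \<open>By continuity a failure at \<open>s\<close> persists on a short interval, and a positive
  density gives every such interval positive probability.\<close>

lemma everywhere_of_AE:
  assumes ae: "AE \<omega> in M. T p (tau 0 \<omega>) v = u" and s: "0 \<le> s"
  shows "T p s v = u"
proof (rule ccontr)
  assume neq: "T p s v \<noteq> u"
  have "isCont (\<lambda>s. T p s v) s"
    using T_cont[of p v] by (simp add: continuous_on_eq_continuous_at)
  then have "\<forall>\<^sub>F r in at s. T p r v \<noteq> u"
    using neq unfolding isCont_def by (rule tendsto_imp_eventually_ne)
  then obtain d where d: "0 < d" "\<And>r. r \<noteq> s \<Longrightarrow> dist r s < d \<Longrightarrow> T p r v \<noteq> u"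
    unfolding eventually_at by auto
  have [measurable]: "f \<in> borel_measurable lborel"
    using tau_density by (rule distributed_borel_measurable)
  \<comment> \<open>Only the half of the neighbourhood to the right of \<open>s\<close> is taken: it
    stays in the nonnegative reals, where \<open>f\<close> is known to be positive.\<close>
  have "AE \<omega> in M. \<not> (tau 0 \<omega> \<in> {s<..<s + d})"
    using ae
  proof eventually_elim
    case (elim \<omega>)
    then show ?case using d(2)[of "tau 0 \<omega>"] by (auto simp: dist_real_def)
  qed
  then have "emeasure M (tau 0 -` {s<..<s + d} \<inter> space M) = 0"
    by (subst (asm) AE_iff_measurable[OF _ refl]) (auto simp: vimage_def Int_def conj_commute)
  then have "(\<integral>\<^sup>+x. f x * indicator {s<..<s + d} x \<partial>lborel) = 0"
    using distributed_emeasure[OF tau_density, of "{s<..<s + d}"] by simp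
  then have "AE x in lborel. f x * indicator {s<..<s + d} x = 0"
    by (subst (asm) nn_integral_0_iff_AE) auto
  then have "AE x in lborel. x \<notin> {s<..<s + d}"
  proof eventually_elim
    case (elim x)
    show ?case
    proof
      assume "x \<in> {s<..<s + d}"
      then have "f x = 0" "0 < f x" using elim s density_pos[of x] by auto
      then show False by simp
    qed
  qed
  then have "emeasure lborel {s<..<s + d} = 0"
    by (subst (asm) AE_iff_measurable[where N = "{s<..<s + d}"]) auto
  then show False using d(1) by simp
qed

text \<open>Equality in Jensen's inequality for the squared norm: the variance of
  \<open>T p (tau 0) v\<close> is the loss of squared norm under averaging.\<close>

lemma T_fixed_of_norm_\<Phi>_eq:
  assumes eq: "norm (\<Phi> p v) = norm v" and "0 \<le> s"
  shows "T p s v = v"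
proof -
  let ?u = "\<Phi> p v"
  have expand: "(norm (T p r v - ?u))\<^sup>2 = (norm v)\<^sup>2 + (norm ?u)\<^sup>2 - 2 * (T p r v \<bullet> ?u)" for r
    by (simp add: dot_norm_neg[of "T p r v" ?u] T_norm field_simps)
  have intI: "integrable M (\<lambda>\<omega>. T p (tau 0 \<omega>) v \<bullet> ?u)"
    using integrable_T by simp
  have int: "integrable M (\<lambda>\<omega>. (norm (T p (tau 0 \<omega>) v - ?u))\<^sup>2)"
    unfolding expand using intI by simp
  have "expectation (\<lambda>\<omega>. T p (tau 0 \<omega>) v \<bullet> ?u) = ?u \<bullet> ?u"
    using integrable_T by (simp add: \<Phi>_def)
  then have "expectation (\<lambda>\<omega>. (norm (T p (tau 0 \<omega>) v - ?u))\<^sup>2) = 0"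
    unfolding expand using intI eq by (simp add: prob_space power2_norm_eq_inner[symmetric])
  then have "AE \<omega> in M. (norm (T p (tau 0 \<omega>) v - ?u))\<^sup>2 = 0"
    using int by (subst (asm) integral_nonneg_eq_0_iff_AE) auto
  then have "AE \<omega> in M. T p (tau 0 \<omega>) v = ?u" by simp
  from everywhere_of_AE[OF this] have "T p r v = ?u" if "0 \<le> r" for r using that .
  \<comment> \<open>The value is constant over all nonnegative times, and time 0 identifies it as
    \<open>v\<close>.\<close>
  from this[of s] this[of 0] \<open>0 \<le> s\<close> show ?thesis by (simp add: T_0)
qed

definition fixed :: "'e set" where
  "fixed = {v. \<forall>p s. 0 \<le> s \<longrightarrow> T p s v = v}"

text \<open>Neither contraction can lose norm if the round trip returns \<open>v\<close>. The
  equality case for \<open>\<Phi> True\<close> shows that \<open>v\<close> is fixed by all of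
  \<open>T True\<close>, hence by \<open>\<Phi> True\<close>; then \<open>\<Phi> False\<close>
  preserves \<open>v\<close> too, and its equality case applies.\<close>

lemma fixed_of_\<Phi>\<Phi>:
  assumes "\<Phi> False (\<Phi> True v) = v"
  shows "v \<in> fixed"
proof -
  have n: "norm (\<Phi> True v) = norm v"
    using norm_\<Phi>_le[of True v] norm_\<Phi>_le[of False "\<Phi> True v"] assms by simp
  have t: "T True s v = v" if "0 \<le> s" for s
    using T_fixed_of_norm_\<Phi>_eq[OF n that] .
  have "AE \<omega> in M. T True (tau 0 \<omega>) v = v"
    using tau_pos by eventually_elim (simp add: t)
  then have "\<Phi> True v = (\<integral>\<omega>. v \<partial>M)"
    unfolding \<Phi>_def by (intro integral_cong_AE) auto
  then have "\<Phi> True v = v" by (simp add: prob_space)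
  with assms have "norm (\<Phi> False v) = norm v" by simp
  from T_fixed_of_norm_\<Phi>_eq[OF this] t have "T p s v = v" if "0 \<le> s" for p s
    using that by (cases p) auto
  then show ?thesis unfolding fixed_def by blast
qed

section \<open>Cesaro averages of the orbit, separated by parity\<close>

lemma orb_orth:
  assumes pos: "\<And>j. 0 < tau j \<omega>" and v: "v \<in> fixed"
  shows "orb \<omega> j \<bullet> v = 0"
proof (induction j)
  case 0
  show ?case using x0_orth v unfolding fixed_def by simp
next
  case (Suc j)
  \<comment> \<open>By polarization the isometries preserve inner products. Since the next map fixes
    \<open>v\<close>, orthogonality to \<open>v\<close> passes from one state to the next.\<close>
  have inner: "T p s a \<bullet> T p s b = a \<bullet> b" for p s a b
    unfolding dot_norm_neg linear_diff[OF T_linear, symmetric] T_norm ..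
  have "T (even j) (tau j \<omega>) v = v"
    using v pos[of j] unfolding fixed_def by simp
  then show ?case using inner[of "even j" "tau j \<omega>" "orb \<omega> j" v] Suc by simp
qed

text \<open>The divisor is \<open>n\<close> and not the number of indices of parity
  \<open>p\<close>, so that shifting the index by one exchanges the parities without changing the
  normalization.\<close>

definition avg :: "'a \<Rightarrow> bool \<Rightarrow> nat \<Rightarrow> 'e" where
  "avg \<omega> p n = (1 / real n) *\<^sub>R (\<Sum>j<n. if even j = p then orb \<omega> j else 0)"

lemma AE_tau_pos: "AE \<omega> in M. \<forall>j. 0 < tau j \<omega>"
  unfolding AE_all_countable using AE_tau[of "\<lambda>x. 0 < x"] tau_pos by simp

lemma linear_avg_sum:
  assumes "linear L"
  shows "(1 / real n) *\<^sub>R (\<Sum>j<n. if even j = p then L (orb \<omega> j) else 0) = L (avg \<omega> p n)"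
  unfolding avg_def linear_scale[OF assms] linear_sum[OF assms]
  using linear_0[OF assms] by (auto intro!: sum.cong arg_cong[where f = "\<lambda>x. (1 / real n) *\<^sub>R x"])

lemma AE_avg_tendsto: "AE \<omega> in M. \<forall>p. avg \<omega> p \<longlonglongrightarrow> 0"
proof -
  have "AE \<omega> in M. \<forall>p. (\<lambda>n. (1 / real n) *\<^sub>R (\<Sum>j<n. if even j = p
     then T p (tau j \<omega>) (orb \<omega> j) - \<Phi> p (orb \<omega> j) else 0)) \<longlonglongrightarrow> 0"
    unfolding AE_all_countable \<Phi>_def
    by (intro allI slln_orbit T_linear T_measurable integrable_T)
  with AE_tau_pos show ?thesis
  proof eventually_elim
    case (elim \<omega>)
    have small: "(\<lambda>n. (1 / real n) *\<^sub>R r n) \<longlonglongrightarrow> 0" if "\<And>n. norm (r n) \<le> 2 * norm x0" for r :: "nat \<Rightarrow> 'e"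
    proof (rule Lim_null_comparison)
      show "\<forall>\<^sub>F n in sequentially. norm ((1 / real n) *\<^sub>R r n) \<le> 2 * norm x0 * inverse (real n)"
      proof (rule always_eventually, rule allI)
        fix n
        show "norm ((1 / real n) *\<^sub>R r n) \<le> 2 * norm x0 * inverse (real n)"
          using mult_right_mono[OF that[of n], of "inverse (real n)"] by (simp add: field_simps)
      qed
      have "(\<lambda>n. 2 * norm x0 * inverse (real n)) \<longlonglongrightarrow> 2 * norm x0 * 0"
        by (intro tendsto_intros lim_inverse_n)
      then show "(\<lambda>n. 2 * norm x0 * inverse (real n)) \<longlonglongrightarrow> 0" by simp
    qed
    have shift: "(\<lambda>n. avg \<omega> (\<not> p) n - \<Phi> p (avg \<omega> p n)) \<longlonglongrightarrow> 0" for p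
    proof -
      define o' where "o' = (\<lambda>j. if even j = (\<not> p) then orb \<omega> j else 0)"
      \<comment> \<open>The mapped state at index \<open>j\<close> is the state at
        \<open>Suc j\<close>, which has the opposite parity. The sum is thus the opposite-parity sum
        shifted by one index, and only two bounded boundary terms remain.\<close>
      have step: "(\<Sum>j<n. if even j = p then T p (tau j \<omega>) (orb \<omega> j) else 0)
          = (\<Sum>j<n. o' j) + (o' n - o' 0)" for n
        by (induction n) (auto simp: o'_def)
      have "norm (o' n - o' 0) \<le> 2 * norm x0" for n
        using norm_triangle_ineq4[of "o' n" "o' 0"] norm_orb[of \<omega> n] by (auto simp: o'_def)
      then have "(\<lambda>n. (1 / real n) *\<^sub>R (o' n - o' 0)) \<longlonglongrightarrow> 0" by (rule small)
      from tendsto_diff[OF elim(2)[rule_format, of p] this]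
      have "(\<lambda>n. (1 / real n) *\<^sub>R (\<Sum>j<n. if even j = p
         then T p (tau j \<omega>) (orb \<omega> j) - \<Phi> p (orb \<omega> j) else 0) - (1 / real n) *\<^sub>R (o' n - o' 0)) \<longlonglongrightarrow> 0"
        by simp
      moreover have "(1 / real n) *\<^sub>R (\<Sum>j<n. if even j = p
         then T p (tau j \<omega>) (orb \<omega> j) - \<Phi> p (orb \<omega> j) else 0) - (1 / real n) *\<^sub>R (o' n - o' 0)
         = avg \<omega> (\<not> p) n - \<Phi> p (avg \<omega> p n)" for n
      proof -
        have "(\<Sum>j<n. if even j = p then T p (tau j \<omega>) (orb \<omega> j) - \<Phi> p (orb \<omega> j) else 0)
          = (\<Sum>j<n. if even j = p then T p (tau j \<omega>) (orb \<omega> j) else 0)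
            - (\<Sum>j<n. if even j = p then \<Phi> p (orb \<omega> j) else 0)"
          unfolding sum_subtractf[symmetric] by (intro sum.cong) auto
        also have "\<dots> = (\<Sum>j<n. o' j) + (o' n - o' 0) - (\<Sum>j<n. if even j = p then \<Phi> p (orb \<omega> j) else 0)"
          unfolding step ..
        finally show ?thesis
          unfolding linear_avg_sum[OF bounded_linear.linear[OF bounded_linear_\<Phi>], of n p, symmetric]
          by (simp add: avg_def o'_def scaleR_diff_right scaleR_add_right)
      qed
      ultimately show ?thesis by simp
    qed
    \<comment> \<open>Pushing the relation for \<open>True\<close> through
      \<open>\<Phi> False\<close> and adding the relation for \<open>False\<close> eliminates
      \<open>avg \<omega> False\<close>; what remains is \<open>G\<close> applied to
      \<open>avg \<omega> True\<close>.\<close>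
    define G where "G = (\<lambda>v. v - \<Phi> False (\<Phi> True v))"
    have "(\<lambda>n. (avg \<omega> True n - \<Phi> False (avg \<omega> False n)) + \<Phi> False (avg \<omega> False n - \<Phi> True (avg \<omega> True n))) \<longlonglongrightarrow> 0 + \<Phi> False 0"
      using shift[of False] shift[of True]
      by (intro tendsto_add bounded_linear.tendsto[OF bounded_linear_\<Phi>]) auto
    then have Glim: "(\<lambda>n. G (avg \<omega> True n)) \<longlonglongrightarrow> 0"
      by (simp add: G_def linear_0[OF bounded_linear.linear[OF bounded_linear_\<Phi>]] linear_diff[OF bounded_linear.linear[OF bounded_linear_\<Phi>]])
    \<comment> \<open>The kernel of \<open>G\<close> consists of fixed vectors, so \<open>G\<close>
      is injective on their orthogonal complement \<open>S\<close>. In finite dimension it is then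
      bounded below on \<open>S\<close>, where the averages of the orbit lie.\<close>
    define S where "S = {v. \<forall>u\<in>fixed. v \<bullet> u = 0}"
    have S_eq: "S = (\<Inter>u\<in>fixed. {v. u \<bullet> v = 0})" by (auto simp: S_def inner_commute)
    have "closed S" unfolding S_eq by (intro closed_INT ballI closed_hyperplane)
    moreover have sub: "subspace S" unfolding S_def subspace_def by (auto simp: inner_add_left)
    moreover have "bounded_linear G"
      unfolding G_def
      by (intro bounded_linear_sub bounded_linear_ident bounded_linear_compose[OF bounded_linear_\<Phi>] bounded_linear_\<Phi>)
    moreover have "\<forall>v\<in>S. G v = 0 \<longrightarrow> v = 0"
    proof (intro ballI impI)
      fix v assume "v \<in> S" "G v = 0"
      then have "v \<in> fixed" by (intro fixed_of_\<Phi>\<Phi>) (simp add: G_def)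
      with \<open>v \<in> S\<close> have "v \<bullet> v = 0" by (simp add: S_def)
      then show "v = 0" by simp
    qed
    ultimately obtain e where e: "0 < e" "\<And>v. v \<in> S \<Longrightarrow> e * norm v \<le> norm (G v)"
      using injective_imp_isometric[of S G] by blast
    have inS: "avg \<omega> True n \<in> S" for n
      unfolding avg_def
    proof (intro subspace_scale[OF sub] subspace_sum[OF sub])
      fix j
      show "(if even j = True then orb \<omega> j else 0) \<in> S"
        using orb_orth[of \<omega>] elim(1) by (auto simp: S_def)
    qed
    have T: "avg \<omega> True \<longlonglongrightarrow> 0"
    proof (rule Lim_null_comparison)
      show "\<forall>\<^sub>F n in sequentially. norm (avg \<omega> True n) \<le> norm (G (avg \<omega> True n)) / e"
        using e inS by (auto simp: pos_le_divide_eq mult.commute)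
      have "(\<lambda>n. norm (G (avg \<omega> True n)) / e) \<longlonglongrightarrow> norm (0::'e) / e"
        using e by (intro tendsto_intros Glim) auto
      then show "(\<lambda>n. norm (G (avg \<omega> True n)) / e) \<longlonglongrightarrow> 0" by simp
    qed
    \<comment> \<open>The other parity follows by the shift relation once more.\<close>
    have "(\<lambda>n. (avg \<omega> False n - \<Phi> True (avg \<omega> True n)) + \<Phi> True (avg \<omega> True n)) \<longlonglongrightarrow> 0 + \<Phi> True 0"
      using shift[of True] by (intro tendsto_add bounded_linear.tendsto[OF bounded_linear_\<Phi>] T) auto
    then have "avg \<omega> False \<longlonglongrightarrow> 0"
      by (simp add: linear_0[OF bounded_linear.linear[OF bounded_linear_\<Phi>]])
    with T show ?case by (auto simp: all_bool_eq)
  qed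
qed

section \<open>From discrete averages to the time average\<close>

definition \<Psi> :: "bool \<Rightarrow> real \<Rightarrow> 'e \<Rightarrow> 'e" where
  "\<Psi> p s v = integral {0..s} (\<lambda>u. T p u v)"

lemma T_integrable_on: "(\<lambda>u. T p u v) integrable_on {a..b}"
  using T_cont by (intro integrable_continuous_real continuous_on_subset[OF T_cont]) auto

lemma linear_\<Psi>: "linear (\<Psi> p s)"
  unfolding \<Psi>_def[abs_def]
  by (intro linearI) (simp_all add: linear_add[OF T_linear] linear_scale[OF T_linear]
      Henstock_Kurzweil_Integration.integral_add T_integrable_on)

lemma norm_\<Psi>_le: "norm (\<Psi> p s v) \<le> \<bar>s\<bar> * norm v"
proof (cases "0 \<le> s")
  case True
  then show ?thesis
    unfolding \<Psi>_def
    using has_integral_bound_real[of "norm v" "{}" "\<lambda>u. T p u v" "\<Psi> p s v" 0 s]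
      integrable_integral[OF T_integrable_on[of p v 0 s]]
    by (simp add: T_norm \<Psi>_def mult.commute)
next
  case False
  then have "\<Psi> p s v = 0" by (simp add: \<Psi>_def)
  then show ?thesis by simp
qed

text \<open>The indefinite integral is continuous on the nonnegative reals and 0 below them, where
  the interval is empty. It therefore equals its composition with \<open>max 0\<close>, which is
  continuous everywhere.\<close>

lemma \<Psi>_measurable: "(\<lambda>s. \<Psi> p s v) \<in> borel_measurable borel"
proof -
  have "isCont (\<lambda>s. \<Psi> p (max 0 s) v) x" for x
  proof -
    let ?b = "\<bar>x\<bar> + 1"
    have "continuous_on {0..?b} (\<lambda>s. \<Psi> p s v)"
      unfolding \<Psi>_def by (rule indefinite_integral_continuous_1[OF T_integrable_on])
    then have "continuous_on {..<?b} (\<lambda>s. \<Psi> p (max 0 s) v)"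
      by (rule continuous_on_compose2) (auto intro!: continuous_intros)
    then show ?thesis
      by (rule continuous_on_interior) (auto simp: interior_open)
  qed
  then have "(\<lambda>s. \<Psi> p (max 0 s) v) \<in> borel_measurable borel"
    by (intro borel_measurable_continuous_onI continuous_at_imp_continuous_on ballI)
  moreover have "\<Psi> p (max 0 s) v = \<Psi> p s v" for s
    by (cases "0 \<le> s") (auto simp: \<Psi>_def max_def)
  ultimately show ?thesis by simp
qed

lemma integrable_\<Psi>: "integrable M (\<lambda>\<omega>. \<Psi> p (tau 0 \<omega>) v)"
proof (rule Bochner_Integration.integrable_bound)
  show "integrable M (\<lambda>\<omega>. tau 0 \<omega> * norm v)" using tau_int by simp
  show "(\<lambda>\<omega>. \<Psi> p (tau 0 \<omega>) v) \<in> borel_measurable M"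
    using measurable_compose[OF tau_measurable \<Psi>_measurable] .
  show "AE \<omega> in M. norm (\<Psi> p (tau 0 \<omega>) v) \<le> norm (tau 0 \<omega> * norm v)"
    using norm_\<Psi>_le by (simp add: abs_mult)
qed

lemma AE_switch_time_limit:
  "AE \<omega> in M. (\<lambda>n. switch_time tau \<omega> n / real n) \<longlonglongrightarrow> expectation (tau 0)"
proof -
  have "AE \<omega> in M. (\<lambda>n. (\<Sum>j<n. 1 * (tau j \<omega> - expectation (\<lambda>\<omega>. tau 0 \<omega>))) / real n) \<longlonglongrightarrow> 0"
    by (rule slln_martingale_transform[where h = "\<lambda>x. x" and w = "\<lambda>_ _. 1" and C = 1])
      (use tau_int in \<open>auto simp: adapted_const\<close>)
  then show ?thesis
  proof eventually_elim
    case (elim \<omega>)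
    have "\<forall>\<^sub>F n in sequentially. (\<Sum>j<n. 1 * (tau j \<omega> - expectation (\<lambda>\<omega>. tau 0 \<omega>))) / real n
        + expectation (tau 0) = switch_time tau \<omega> n / real n"
      using eventually_gt_at_top[of 0]
      by eventually_elim (simp add: switch_time_def sum_subtractf diff_divide_distrib)
    moreover have "(\<lambda>n. (\<Sum>j<n. 1 * (tau j \<omega> - expectation (\<lambda>\<omega>. tau 0 \<omega>))) / real n
        + expectation (tau 0)) \<longlonglongrightarrow> 0 + expectation (tau 0)"
      by (intro tendsto_intros elim)
    ultimately show ?case by (simp add: tendsto_cong)
  qed
qed

text \<open>The path \<open>y\<close> is quantified inside the almost sure statement, so that one
  null set serves every function following the orbit on the half-open intervals between
  switches.\<close>

theorem AE_time_average:
  "AE \<omega> in M. \<forall>y. (\<forall>j t. switch_time tau \<omega> j \<le> t \<longrightarrow> t < switch_time tau \<omega> (Suc j) \<longrightarrow>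
      y t = T (even j) (t - switch_time tau \<omega> j) (orb \<omega> j)) \<longrightarrow>
    (\<forall>t. y integrable_on {0..t}) \<and> ((\<lambda>t. (1 / t) *\<^sub>R integral {0..t} y) \<longlongrightarrow> 0) at_top"
proof -
  have "AE \<omega> in M. \<forall>p. (\<lambda>n. (1 / real n) *\<^sub>R (\<Sum>j<n. if even j = p
     then \<Psi> p (tau j \<omega>) (orb \<omega> j) - (\<integral>\<omega>'. \<Psi> p (tau 0 \<omega>') (orb \<omega> j) \<partial>M) else 0)) \<longlonglongrightarrow> 0"
    unfolding AE_all_countable
    by (intro allI slln_orbit linear_\<Psi> \<Psi>_measurable integrable_\<Psi>)
  with AE_tau_pos AE_avg_tendsto AE_switch_time_limit show ?thesis
  proof eventually_elim
    case (elim \<omega>)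
    define t where "t = switch_time tau \<omega>"
    have t0: "t 0 = 0" and tSuc: "t (Suc n) = t n + tau n \<omega>" for n
      by (simp_all add: t_def switch_time_def)
    have mono: "strict_mono t"
      using elim(1) by (intro strict_monoI_Suc) (simp add: tSuc)
    have pos: "0 < expectation (tau 0)"
      using tau_int tau_pos by (rule expectation_greater)
    define E where "E = (\<lambda>p v. \<integral>\<omega>'. \<Psi> p (tau 0 \<omega>') v \<partial>M)"
    have E: "bounded_linear (E p)" for p
      unfolding E_def by (rule bounded_linear_expectation[OF linear_\<Psi> integrable_\<Psi>])
    \<comment> \<open>Replacing each interval integral by its mean costs nothing in the limit. The
      mean is a fixed linear map \<open>E p\<close> of the state, so the means average to
      \<open>E p (avg \<omega> p n)\<close>, which tends to 0.\<close>
    have half: "(\<lambda>n. (1 / real n) *\<^sub>R (\<Sum>j<n. if even j = p then \<Psi> p (tau j \<omega>) (orb \<omega> j) else 0)) \<longlonglongrightarrow> 0" for p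
    proof -
      have "(\<lambda>n. (1 / real n) *\<^sub>R (\<Sum>j<n. if even j = p
          then \<Psi> p (tau j \<omega>) (orb \<omega> j) - E p (orb \<omega> j) else 0) + E p (avg \<omega> p n)) \<longlonglongrightarrow> 0 + E p 0"
      proof (rule tendsto_add)
        show "(\<lambda>n. (1 / real n) *\<^sub>R (\<Sum>j<n. if even j = p
            then \<Psi> p (tau j \<omega>) (orb \<omega> j) - E p (orb \<omega> j) else 0)) \<longlonglongrightarrow> 0"
          unfolding E_def using elim(4) by blast
        show "(\<lambda>n. E p (avg \<omega> p n)) \<longlonglongrightarrow> E p 0"
          using elim(2) by (intro bounded_linear.tendsto[OF E]) blast
      qed
      moreover have "(1 / real n) *\<^sub>R (\<Sum>j<n. if even j = p
          then \<Psi> p (tau j \<omega>) (orb \<omega> j) - E p (orb \<omega> j) else 0) + E p (avg \<omega> p n)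
          = (1 / real n) *\<^sub>R (\<Sum>j<n. if even j = p then \<Psi> p (tau j \<omega>) (orb \<omega> j) else 0)" for n
        unfolding linear_avg_sum[OF bounded_linear.linear[OF E], of n p, symmetric]
          scaleR_add_right[symmetric] sum.distrib[symmetric]
        by (intro arg_cong[where f = "\<lambda>x. (1 / real n) *\<^sub>R x"] sum.cong) auto
      ultimately show ?thesis by (simp add: linear_0[OF bounded_linear.linear[OF E]])
    qed
    show ?case
    proof (intro allI impI)
      fix y
      assume "\<forall>j s. switch_time tau \<omega> j \<le> s \<longrightarrow> s < switch_time tau \<omega> (Suc j) \<longrightarrow>
        y s = T (even j) (s - switch_time tau \<omega> j) (orb \<omega> j)"
      then have y: "y s = T (even j) (s - t j) (orb \<omega> j)" if "t j \<le> s" "s < t (Suc j)" for j s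
        using that by (simp add: t_def)
      \<comment> \<open>At the right endpoint the formula of the next interval applies; a single
        point does not affect the integral.\<close>
      have piece: "(y has_integral \<Psi> (even j) (tau j \<omega>) (orb \<omega> j)) {t j..t (Suc j)}" for j
      proof -
        have "((\<lambda>u. T (even j) u (orb \<omega> j)) has_integral \<Psi> (even j) (tau j \<omega>) (orb \<omega> j)) {0..tau j \<omega>}"
          unfolding \<Psi>_def using T_integrable_on by (rule integrable_integral)
        from has_integral_shift_real_ivl[OF this, of "- t j"]
        have "((\<lambda>s. T (even j) (s - t j) (orb \<omega> j)) has_integral \<Psi> (even j) (tau j \<omega>) (orb \<omega> j)) {t j..t (Suc j)}"
          by (simp add: tSuc add.commute)
        then show ?thesis
          by (rule has_integral_spike_finite[rotated 2, where S = "{t (Suc j)}"]) (auto intro: y)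
      qed
      have total: "(y has_integral (\<Sum>j<n. \<Psi> (even j) (tau j \<omega>) (orb \<omega> j))) {0..t n}" for n
      proof (induction n)
        case 0
        show ?case using has_integral_refl[of y "0::real"] by (simp add: t0)
      next
        case (Suc n)
        have "0 \<le> t n" "t n \<le> t (Suc n)"
          using strict_mono_less_eq[OF mono, of 0 n] strict_mono_less_eq[OF mono, of n "Suc n"] t0 by simp_all
        from has_integral_combine[OF this Suc piece] show ?case by simp
      qed
      have "(\<lambda>n. (1 / real n) *\<^sub>R (\<Sum>j<n. if even j = True then \<Psi> True (tau j \<omega>) (orb \<omega> j) else 0)
          + (1 / real n) *\<^sub>R (\<Sum>j<n. if even j = False then \<Psi> False (tau j \<omega>) (orb \<omega> j) else 0)) \<longlonglongrightarrow> 0 + 0"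
        by (intro tendsto_add half)
      moreover have "(1 / real n) *\<^sub>R (\<Sum>j<n. if even j = True then \<Psi> True (tau j \<omega>) (orb \<omega> j) else 0)
          + (1 / real n) *\<^sub>R (\<Sum>j<n. if even j = False then \<Psi> False (tau j \<omega>) (orb \<omega> j) else 0)
          = (1 / real n) *\<^sub>R integral {0..t n} y" for n
        unfolding integral_unique[OF total] scaleR_add_right[symmetric] sum.distrib[symmetric]
        by (intro arg_cong[where f = "\<lambda>x. (1 / real n) *\<^sub>R x"] sum.cong) auto
      ultimately have avg0: "(\<lambda>n. (1 / real n) *\<^sub>R integral {0..t n} y) \<longlonglongrightarrow> 0" by simp
      have lim: "(\<lambda>n. t n / real n) \<longlonglongrightarrow> expectation (tau 0)" using elim(3) by (simp add: t_def)
      have int: "y integrable_on {0..t n}" for n using total[of n] by blast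
      have bound: "norm (y s) \<le> norm x0" if "t j \<le> s" "s < t (Suc j)" for j s
        using y[OF that] by (simp add: T_norm norm_orb)
      show "(\<forall>t. y integrable_on {0..t}) \<and> ((\<lambda>s. (1 / s) *\<^sub>R integral {0..s} y) \<longlongrightarrow> 0) at_top"
      proof (intro conjI allI)
        show "y integrable_on {0..s}" for s
          by (rule time_average_tendsto_zero(1)[OF t0 mono lim pos int _ avg0]) (rule bound)
        show "((\<lambda>s. (1 / s) *\<^sub>R integral {0..s} y) \<longlongrightarrow> 0) at_top"
          by (rule time_average_tendsto_zero(2)[OF t0 mono lim pos int _ avg0]) (rule bound)
      qed
    qed
  qed
qed

end

section \<open>Unitary evolutions and their commutant\<close>

lemma cadj_mult: "cadj (A ** B) = cadj B ** cadj A"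
  by (simp add: cadj_def matrix_matrix_mult_def vec_eq_iff cnj_sum mult.commute)

lemma cadj_mat_1: "cadj (mat 1) = mat 1"
  by (auto simp: cadj_def mat_def vec_eq_iff)

lemma cadj_cadj: "cadj (cadj A) = A"
  by (simp add: cadj_def vec_eq_iff)

text \<open>The built-in real inner product is the real part of the Hilbert-Schmidt product.
  Cyclicity of the trace then makes unitary conjugation an isometry, and orthogonality to scalars
  becomes a statement about the trace.\<close>

lemma inner_cmat: "A \<bullet> B = Re (trace (A ** cadj B))" for A B :: "complex^'n::finite^'n"
  by (simp add: inner_vec_def trace_def matrix_matrix_mult_def cadj_def inner_complex_def Re_sum)

lemma unitary_group_right: "U \<in> unitary_group \<Longrightarrow> U ** cadj U = mat 1"
  unfolding unitary_group_def by (simp add: matrix_left_right_inverse)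

lemma unitary_group_mult:
  assumes "U \<in> unitary_group" "V \<in> unitary_group" shows "U ** V \<in> unitary_group"
proof -
  have "cadj (U ** V) ** (U ** V) = cadj V ** (cadj U ** U) ** V"
    by (simp add: cadj_mult matrix_mul_assoc)
  then show ?thesis using assms by (simp add: unitary_group_def)
qed

lemma unitary_group_1: "mat 1 \<in> unitary_group"
  by (simp add: unitary_group_def cadj_mat_1)

definition conj_by :: "complex^'n::finite^'n \<Rightarrow> complex^'n^'n \<Rightarrow> complex^'n^'n" where
  "conj_by U v = U ** v ** cadj U"

lemma conj_by_entry: "conj_by U v $ a $ b = (\<Sum>l\<in>UNIV. \<Sum>k\<in>UNIV. U $ a $ k * v $ k $ l * cnj (U $ b $ l))"
  by (simp add: conj_by_def matrix_matrix_mult_def cadj_def sum_distrib_right)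

lemma linear_conj_by: "linear (conj_by U)"
  by (rule linearI)
    (simp_all add: vec_eq_iff conj_by_entry algebra_simps sum.distrib scaleR_sum_right)

lemma conj_by_mult: "conj_by (U ** V) v = conj_by U (conj_by V v)"
  by (simp add: conj_by_def cadj_mult matrix_mul_assoc)

lemma conj_by_1: "conj_by (mat 1) v = v"
  by (simp add: conj_by_def cadj_mat_1)

lemma norm_conj_by:
  assumes "U \<in> unitary_group" shows "norm (conj_by U v) = norm v"
proof -
  have "conj_by U v ** cadj (conj_by U v) = U ** v ** (cadj U ** U) ** cadj v ** cadj U"
    by (simp add: conj_by_def cadj_mult cadj_cadj matrix_mul_assoc)
  also have "\<dots> = U ** (v ** cadj v ** cadj U)"
    using assms by (simp add: unitary_group_def matrix_mul_assoc)
  finally have "trace (conj_by U v ** cadj (conj_by U v)) = trace (v ** cadj v ** cadj U ** U)"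
    by (simp add: trace_mul_sym[of U])
  also have "\<dots> = trace (v ** cadj v)"
    using assms by (simp add: unitary_group_def matrix_mul_assoc[symmetric])
  finally show ?thesis by (simp add: norm_eq_sqrt_inner inner_cmat)
qed

lemma conj_by_scalar:
  assumes "U \<in> unitary_group" shows "conj_by U (cscale c (mat 1)) = cscale c (mat 1)"
proof -
  have "conj_by U (cscale c (mat 1)) = cscale c (U ** cadj U)"
    by (simp add: vec_eq_iff conj_by_entry cscale_def matrix_matrix_mult_def cadj_def mat_def
        sum_distrib_left if_distrib if_distribR mult_ac cong: if_cong)
  then show ?thesis using unitary_group_right[OF assms] by simp
qed

section \<open>The matrix exponential through entrywise power series\<close>

lemma matpow_cscale: "matpow (cscale c A) k = cscale (c ^ k) (matpow A k)"
  by (induction k) (auto simp: cscale_def vec_eq_iff matrix_matrix_mult_def sum_distrib_left mult_ac)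

text \<open>The total modulus of all entries dominates every row sum, so each further multiplication
  costs one such factor. A geometric bound suffices for the exponential series to converge
  everywhere.\<close>

lemma norm_matpow_entry_le:
  "norm (matpow A k $ i $ j) \<le> (\<Sum>a\<in>UNIV. \<Sum>b\<in>UNIV. norm (A $ a $ b)) ^ k"
proof (induction k arbitrary: i)
  case 0
  show ?case by (simp add: mat_def)
next
  case (Suc k)
  let ?B = "\<Sum>a\<in>UNIV. \<Sum>b\<in>UNIV. norm (A $ a $ b)"
  have "norm (matpow A (Suc k) $ i $ j) \<le> (\<Sum>l\<in>UNIV. norm (A $ i $ l) * norm (matpow A k $ l $ j))"
    by (simp add: matrix_matrix_mult_def norm_mult[symmetric] norm_sum)
  also have "\<dots> \<le> (\<Sum>l\<in>UNIV. norm (A $ i $ l) * ?B ^ k)"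
    by (intro sum_mono mult_left_mono Suc) auto
  also have "\<dots> = (\<Sum>l\<in>UNIV. norm (A $ i $ l)) * ?B ^ k" by (simp add: sum_distrib_right)
  also have "\<dots> \<le> ?B * ?B ^ k"
    by (intro mult_right_mono member_le_sum[of i UNIV "\<lambda>a. \<Sum>b\<in>UNIV. norm (A $ a $ b)"])
      (auto intro!: sum_nonneg zero_le_power)
  finally show ?case by simp
qed

text \<open>The coefficient of \<open>z ^ k\<close> in entry \<open>i j\<close> of the exponential
  of \<open>z\<close> times \<open>H\<close>. Scalar power series can then be evaluated and
  differentiated at \<open>- \<i> * complex_of_real t\<close>.\<close>

definition exp_coeff :: "complex^'n::finite^'n \<Rightarrow> 'n \<Rightarrow> 'n \<Rightarrow> nat \<Rightarrow> complex" where
  "exp_coeff H i j k = matpow H k $ i $ j / fact k"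

lemma summable_exp_coeff: "summable (\<lambda>k. exp_coeff H i j k * z ^ k)"
proof (rule summable_comparison_test')
  let ?B = "\<Sum>a\<in>UNIV. \<Sum>b\<in>UNIV. norm (H $ a $ b)"
  show "summable (\<lambda>k. inverse (fact k) * (?B * norm z) ^ k)" by (rule summable_exp)
  fix k :: nat
  have "norm (exp_coeff H i j k * z ^ k) = norm (matpow H k $ i $ j) * norm z ^ k / fact k"
    by (simp add: exp_coeff_def norm_mult norm_divide norm_power)
  also have "\<dots> \<le> ?B ^ k * norm z ^ k / fact k"
    by (intro divide_right_mono mult_right_mono norm_matpow_entry_le) auto
  finally show "norm (exp_coeff H i j k * z ^ k) \<le> inverse (fact k) * (?B * norm z) ^ k"
    by (simp add: power_mult_distrib field_simps)
qed

lemma evol_entry: "evol H t $ i $ j = (\<Sum>k. exp_coeff H i j k * (- \<i> * complex_of_real t) ^ k)"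
proof -
  let ?z = "- \<i> * complex_of_real t"
  define L where "L = (\<chi> i j. \<Sum>k. exp_coeff H i j k * ?z ^ k)"
  have "(\<lambda>k. (1 / fact k) *\<^sub>R matpow (cscale ?z H) k) sums L"
    unfolding sums_def
  proof (intro vec_tendstoI)
    fix i j
    have "(\<lambda>n. \<Sum>k<n. exp_coeff H i j k * ?z ^ k) \<longlonglongrightarrow> L $ i $ j"
      using summable_sums[OF summable_exp_coeff] unfolding sums_def L_def by simp
    moreover have "((1 / fact k) *\<^sub>R matpow (cscale ?z H) k) $ i $ j = exp_coeff H i j k * ?z ^ k" for k
      unfolding matpow_cscale vector_scaleR_component
      by (simp add: cscale_def exp_coeff_def scaleR_conv_of_real)
    then have "(\<Sum>k<n. (1 / fact k) *\<^sub>R matpow (cscale ?z H) k) $ i $ j = (\<Sum>k<n. exp_coeff H i j k * ?z ^ k)" for n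
      by (simp only: sum_component)
    ultimately show "(\<lambda>n. (\<Sum>k<n. (1 / fact k) *\<^sub>R matpow (cscale ?z H) k) $ i $ j) \<longlonglongrightarrow> L $ i $ j"
      by simp
  qed
  then have "evol H t = L" unfolding evol_def mexp_def by (simp add: sums_iff)
  then show ?thesis by (simp add: L_def)
qed

lemma evol_0: "evol H 0 = mat 1"
  using powser_zero[of "exp_coeff H i j" for i j]
  by (simp add: vec_eq_iff evol_entry exp_coeff_def)

lemma evol_derivative:
  "((\<lambda>t. evol H t $ i $ j) has_vector_derivative (- \<i> * (\<Sum>l\<in>UNIV. H $ i $ l * evol H t $ l $ j))) (at t)"
proof -
  let ?z = "\<lambda>t. - \<i> * complex_of_real t"
  let ?d = "\<lambda>z. \<Sum>k. diffs (exp_coeff H i j) k * z ^ k"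
  have "((\<lambda>z. \<Sum>k. exp_coeff H i j k * z ^ k) has_field_derivative ?d z) (at z)" for z
    by (rule termdiffs_strong_converges_everywhere) (rule summable_exp_coeff)
  moreover have "(?z has_vector_derivative - \<i>) (at t)"
    by (auto intro!: derivative_eq_intros)
  ultimately have "((\<lambda>z. \<Sum>k. exp_coeff H i j k * z ^ k) \<circ> ?z has_vector_derivative (- \<i> * ?d (?z t))) (at t)"
    by (intro field_vector_diff_chain_at)
  moreover have "?d z = (\<Sum>l\<in>UNIV. H $ i $ l * (\<Sum>k. exp_coeff H l j k * z ^ k))" for z
  proof -
    have "(\<lambda>k. \<Sum>l\<in>UNIV. H $ i $ l * (exp_coeff H l j k * z ^ k)) sums
        (\<Sum>l\<in>UNIV. H $ i $ l * (\<Sum>k. exp_coeff H l j k * z ^ k))"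
      by (intro sums_sum sums_mult summable_sums summable_exp_coeff)
    \<comment> \<open>Differentiation turns \<open>1 / fact (Suc k)\<close> into
      \<open>1 / fact k\<close> and leaves one extra factor \<open>H\<close>, which
      \<open>matpow\<close> puts on the left.\<close>
    moreover have "diffs (exp_coeff H i j) k * z ^ k = (\<Sum>l\<in>UNIV. H $ i $ l * (exp_coeff H l j k * z ^ k))" for k
    proof -
      have "diffs (exp_coeff H i j) k = matpow H (Suc k) $ i $ j / fact k"
        by (simp add: diffs_def exp_coeff_def del: of_nat_Suc matpow.simps)
      then show ?thesis
        by (simp add: exp_coeff_def matrix_matrix_mult_def sum_divide_distrib sum_distrib_right mult.assoc)
    qed
    ultimately show ?thesis by (simp add: sums_iff)
  qed
  ultimately show ?thesis by (simp add: o_def evol_entry)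
qed

lemma continuous_on_evol_entry: "continuous_on S (\<lambda>t. evol H t $ i $ j)"
  by (intro continuous_at_imp_continuous_on ballI has_vector_derivative_continuous[OF evol_derivative])

text \<open>Each entry of the adjoint times the evolution has derivative 0, because the two terms of
  the product rule cancel for hermitian \<open>H\<close>, and at time 0 the product is the
  identity.\<close>

lemma evol_unitary:
  assumes "hermitian H" shows "evol H t \<in> unitary_group"
proof -
  have H: "cnj (H $ a $ b) = H $ b $ a" for a b
  proof -
    have "cadj H $ b $ a = H $ b $ a" using assms by (simp add: hermitian_def)
    then show ?thesis by (simp add: cadj_def)
  qed
  have "(cadj (evol H t) ** evol H t) $ i $ j = mat 1 $ i $ j" for i j
  proof -
    define g where "g = (\<lambda>t. \<Sum>k\<in>UNIV. cnj (evol H t $ k $ i) * evol H t $ k $ j)"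
    have "(g has_vector_derivative 0) (at s)" for s
    proof -
      let ?u = "evol H s"
      have "(g has_vector_derivative (\<Sum>k\<in>UNIV. cnj (?u $ k $ i) * (- \<i> * (\<Sum>l\<in>UNIV. H $ k $ l * ?u $ l $ j))
          + cnj (- \<i> * (\<Sum>l\<in>UNIV. H $ k $ l * ?u $ l $ i)) * ?u $ k $ j)) (at s)"
        unfolding g_def
        by (intro has_vector_derivative_sum has_vector_derivative_mult has_vector_derivative_cnj evol_derivative)
      moreover have "(\<Sum>k\<in>UNIV. cnj (?u $ k $ i) * (- \<i> * (\<Sum>l\<in>UNIV. H $ k $ l * ?u $ l $ j))
          + cnj (- \<i> * (\<Sum>l\<in>UNIV. H $ k $ l * ?u $ l $ i)) * ?u $ k $ j)
          = \<i> * ((\<Sum>k\<in>UNIV. \<Sum>l\<in>UNIV. H $ l $ k * cnj (?u $ l $ i) * ?u $ k $ j)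
             - (\<Sum>k\<in>UNIV. \<Sum>l\<in>UNIV. H $ k $ l * cnj (?u $ k $ i) * ?u $ l $ j))"
        by (simp add: H cnj_sum sum.distrib sum_distrib_left sum_distrib_right right_diff_distrib
            sum_subtractf sum_negf mult_ac)
      \<comment> \<open>The two double sums differ only in the names of their summation
        indices.\<close>
      moreover have "(\<Sum>k\<in>UNIV. \<Sum>l\<in>UNIV. H $ l $ k * cnj (?u $ l $ i) * ?u $ k $ j)
          = (\<Sum>k\<in>UNIV. \<Sum>l\<in>UNIV. H $ k $ l * cnj (?u $ k $ i) * ?u $ l $ j)"
        by (rule sum.swap)
      ultimately show ?thesis by simp
    qed
    then obtain c where "\<And>s. g s = c"
      using has_vector_derivative_zero_constant[of UNIV g] by auto
    then have "g t = g 0" by simp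
    also have "g 0 = (cadj (mat 1) ** mat 1) $ i $ j"
      by (simp only: g_def evol_0 cadj_def matrix_matrix_mult_def vec_lambda_beta)
    finally show ?thesis
      by (simp add: g_def cadj_mat_1) (simp add: cadj_def matrix_matrix_mult_def)
  qed
  then show ?thesis unfolding unitary_group_def by (simp add: vec_eq_iff)
qed

lemma continuous_on_conj_by_evol: "continuous_on S (\<lambda>s. conj_by (evol H s) v)"
proof -
  have "continuous_on S (\<lambda>s. \<chi> a b. conj_by (evol H s) v $ a $ b)"
    unfolding conj_by_entry
    by (intro continuous_on_vec_lambda continuous_intros continuous_on_evol_entry)
  then show ?thesis by simp
qed

section \<open>Phased permutations and the commutant of the unitary group\<close>

definition monomial_matrix :: "('n \<Rightarrow> complex) \<Rightarrow> ('n \<Rightarrow> 'n) \<Rightarrow> complex^'n::finite^'n" where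
  "monomial_matrix d \<pi> = (\<chi> a b. if b = \<pi> a then d a else 0)"

lemma monomial_matrix_unitary:
  assumes "bij \<pi>" "\<And>a. norm (d a) = 1"
  shows "monomial_matrix d \<pi> \<in> unitary_group"
proof -
  have d: "cnj (d k) * d k = 1" for k
    using complex_norm_square[of "d k"] assms(2)[of k] by (simp add: mult.commute)
  have "(\<Sum>k\<in>UNIV. cnj (if a = \<pi> k then d k else 0) * (if b = \<pi> k then d k else 0)) = (if a = b then 1 else 0)" for a b
  proof -
    have "(\<Sum>k\<in>UNIV. cnj (if a = \<pi> k then d k else 0) * (if b = \<pi> k then d k else 0))
        = (\<Sum>k\<in>UNIV. if a = \<pi> k \<and> a = b then 1 else 0 :: complex)"
      by (intro sum.cong) (auto simp: d)
    also have "\<dots> = (\<Sum>k\<in>UNIV. if a = k \<and> a = b then 1 else 0)"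
      using sum.reindex_bij_betw[OF assms(1), of "\<lambda>k. if a = k \<and> a = b then 1 else 0 :: complex"] by simp
    finally show ?thesis by auto
  qed
  then show ?thesis
    by (simp add: unitary_group_def monomial_matrix_def cadj_def matrix_matrix_mult_def mat_def vec_eq_iff)
qed

lemma conj_by_monomial: "conj_by (monomial_matrix d \<pi>) v $ a $ b = d a * v $ \<pi> a $ \<pi> b * cnj (d b)"
proof -
  have "conj_by (monomial_matrix d \<pi>) v $ a $ b
      = (\<Sum>l\<in>UNIV. \<Sum>k\<in>UNIV. if k = \<pi> a then if l = \<pi> b then d a * v $ k $ l * cnj (d b) else 0 else 0)"
    unfolding conj_by_entry monomial_matrix_def by (intro sum.cong refl) simp
  then show ?thesis by simp
qed

text \<open>Two kinds of test unitaries suffice. Flipping the sign of coordinate \<open>i\<close>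
  forces an off-diagonal entry in row \<open>i\<close> to equal its negative, and exchanging two
  coordinates equates their diagonal entries.\<close>

lemma scalar_of_conj_invariant:
  fixes v :: "complex^'n::finite^'n"
  assumes inv: "\<And>U. U \<in> unitary_group \<Longrightarrow> conj_by U v = v"
  shows "\<exists>c. v = cscale c (mat 1)"
proof -
  have off: "v $ i $ j = 0" if "i \<noteq> j" for i j
  proof -
    let ?d = "\<lambda>a. if a = i then -1 else 1 :: complex"
    have "conj_by (monomial_matrix ?d id) v $ i $ j = v $ i $ j"
      using inv[OF monomial_matrix_unitary[of id ?d]] by simp
    then show ?thesis using that by (simp add: conj_by_monomial)
  qed
  have diag: "v $ i $ i = v $ j $ j" for i j
  proof -
    let ?p = "Transposition.transpose i j"
    have "conj_by (monomial_matrix (\<lambda>_. 1) ?p) v $ i $ i = v $ i $ i"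
      using inv[OF monomial_matrix_unitary[of ?p "\<lambda>_. 1"]] by simp
    then show ?thesis by (simp add: conj_by_monomial)
  qed
  \<comment> \<open>\<open>undefined\<close> is merely some index: all diagonal entries agree, so
    any of them gives the scalar.\<close>
  have "v = cscale (v $ undefined $ undefined) (mat 1)"
    using off diag[of _ undefined] by (auto simp: vec_eq_iff cscale_def mat_def)
  then show ?thesis by blast
qed

section \<open>Alternating products of evolutions\<close>

lemma Jprod_unitary:
  assumes "hermitian H1" "hermitian H2" shows "Jprod H1 H2 n s \<in> unitary_group"
  using assms by (induction n) (auto intro: unitary_group_mult unitary_group_1 evol_unitary)

lemma Jprod_cong: "(\<And>j. 1 \<le> j \<Longrightarrow> j \<le> n \<Longrightarrow> s j = s' j) \<Longrightarrow> Jprod H1 H2 n s = Jprod H1 H2 n s'"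
  by (induction n) auto

lemma conj_by_Jprod_fixed:
  assumes "\<And>s. 0 \<le> s \<Longrightarrow> conj_by (evol H1 s) v = v" "\<And>s. 0 \<le> s \<Longrightarrow> conj_by (evol H2 s) v = v"
    and "\<forall>j\<in>{1..n}. 0 \<le> s j"
  shows "conj_by (Jprod H1 H2 n s) v = v"
  using assms by (induction n) (auto simp: conj_by_mult conj_by_1)

text \<open>Every unitary is an alternating product of evolutions over nonnegative times, so what
  the factors fix is fixed under conjugation by the whole unitary group.\<close>

lemma U_controllable_fixed_scalar:
  assumes "U_controllable H1 H2"
    and "\<And>s. 0 \<le> s \<Longrightarrow> conj_by (evol H1 s) v = v" "\<And>s. 0 \<le> s \<Longrightarrow> conj_by (evol H2 s) v = v"
  shows "\<exists>c. v = cscale c (mat 1)"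
proof (rule scalar_of_conj_invariant)
  fix U :: "complex^'a^'a" assume U: "U \<in> unitary_group"
  obtain n where "{Jprod H1 H2 n s | s. \<forall>j\<in>{1..n}. 0 \<le> s j} = unitary_group"
    using assms(1) unfolding U_controllable_def by blast
  with U obtain s where "U = Jprod H1 H2 n s" "\<forall>j\<in>{1..n}. 0 \<le> s j" by blast
  then show "conj_by U v = v" using conj_by_Jprod_fixed[OF assms(2,3)] by simp
qed

text \<open>The least \<open>n\<close> with \<open>t < switch_time tau \<omega> n\<close> is
  \<open>Suc j\<close>, so the unfinished last factor has number \<open>Suc j\<close> and uses
  \<open>H1\<close> exactly when \<open>j\<close> is even. Factors count from 1 and
  \<open>tau\<close> from 0, hence the argument \<open>i - 1\<close>.\<close>

lemma Xpath_on_interval: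
  assumes pos: "\<And>j. 0 < tau j \<omega>"
    and t: "switch_time tau \<omega> j \<le> t" "t < switch_time tau \<omega> (Suc j)"
  shows "Xpath H1 H2 tau \<omega> t
     = evol (if even j then H1 else H2) (t - switch_time tau \<omega> j) ** Jprod H1 H2 j (\<lambda>i. tau (i - 1) \<omega>)"
proof -
  have mono: "strict_mono (switch_time tau \<omega>)"
    using pos by (intro strict_monoI_Suc) (simp add: switch_time_def)
  have "(LEAST n. t < switch_time tau \<omega> n) = Suc j"
  proof (rule Least_equality)
    fix n assume "t < switch_time tau \<omega> n"
    then have "switch_time tau \<omega> j < switch_time tau \<omega> n" using t by linarith
    then show "Suc j \<le> n" using mono by (simp add: strict_mono_less Suc_le_eq)
  qed (rule t)
  moreover define s where "s = (\<lambda>i. if i < Suc j then tau (i - 1) \<omega> else t - switch_time tau \<omega> (Suc j - 1))"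
  ultimately have "Xpath H1 H2 tau \<omega> t = Jprod H1 H2 (Suc j) s"
    by (simp only: Xpath_def Let_def)
  moreover have "s (Suc j) = t - switch_time tau \<omega> j" by (simp add: s_def)
  moreover have "Jprod H1 H2 j s = Jprod H1 H2 j (\<lambda>i. tau (i - 1) \<omega>)"
    by (rule Jprod_cong) (simp add: s_def)
  ultimately show ?thesis by simp
qed

lemma Xpath_unitary:
  "hermitian H1 \<Longrightarrow> hermitian H2 \<Longrightarrow> Xpath H1 H2 tau \<omega> t \<in> unitary_group"
  by (simp add: Xpath_def Let_def Jprod_unitary)

section \<open>Convergence of the state to the maximally mixed one in time average\<close>

theorem mainTheorem13:
  fixes M :: "'a measure"
    and tau :: "nat \<Rightarrow> 'a \<Rightarrow> real"
    and f :: "real \<Rightarrow> ennreal"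
    and H1 H2 \<rho>0 :: "complex^'n::finite^'n"
  assumes "prob_space M"
    and "\<And>i. tau i \<in> borel_measurable M"
    and "prob_space.indep_vars M (\<lambda>_. borel) tau UNIV"
    and "\<And>i. distr M borel (tau i) = distr M borel (tau 0)"
    and "\<And>i. AE \<omega> in M. 0 < tau i \<omega>"
    and "integrable M (tau 0)"
    and "distributed M lborel (tau 0) f"
    and "\<And>x. 0 \<le> x \<Longrightarrow> 0 < f x"
    and "hermitian H1" and "hermitian H2"
    and "U_controllable H1 H2"
    and "density_matrix \<rho>0"
  shows "AE \<omega> in M. \<forall>A::complex^'n^'n. hermitian A \<longrightarrow>
     ((\<lambda>T. (1 / complex_of_real T) *
         integral {0..T} (\<lambda>t. trace ((Xpath H1 H2 tau \<omega> t ** \<rho>0 ** cadj (Xpath H1 H2 tau \<omega> t)) ** A)))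
      \<longlongrightarrow> trace (cscale (1 / of_nat CARD('n)) (mat 1) ** A)) at_top"
proof -
  define N where "N = (of_nat CARD('n) :: complex)"
  have N: "N \<noteq> 0" by (simp add: N_def)
  define E where "E = (cscale (1 / N) (mat 1) :: complex^'n^'n)"
  define x0 where "x0 = \<rho>0 - E"
  have "trace E = 1"
    using N by (simp add: E_def N_def trace_def cscale_def mat_def)
  then have tr0: "trace x0 = 0"
    using assms(12) by (simp add: x0_def density_matrix_def trace_sub)
  interpret prob_space M by fact
  interpret iid_times M tau
    by unfold_locales (use assms(2-4) in auto)
  define T where "T = (\<lambda>p s. conj_by (evol (if p then H1 else H2) s))"
  have T: "T p s v = conj_by (evol (if p then H1 else H2) s) v" for p s v by (simp add: T_def)
  interpret isometric_switching M tau T x0 f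
  proof (intro isometric_switching.intro isometric_switching_axioms.intro)
    show "iid_times M tau" ..
    show "linear (T p s)" for p s unfolding T_def by (rule linear_conj_by)
    show "norm (T p s v) = norm v" for p s v
      unfolding T_def using assms(9,10) by (intro norm_conj_by evol_unitary) simp
    show "continuous_on UNIV (\<lambda>s. T p s v)" for p v
      unfolding T_def by (rule continuous_on_conj_by_evol)
    show "T p 0 v = v" for p v by (simp add: T_def evol_0 conj_by_1)
    show "x0 \<bullet> v = 0" if "\<And>p s. 0 \<le> s \<Longrightarrow> T p s v = v" for v
    proof -
      have "\<exists>c. v = cscale c (mat 1)"
        using that[of _ True] that[of _ False]
        by (intro U_controllable_fixed_scalar[OF assms(11)]) (simp_all add: T_def)
      then obtain c where "v = cscale c (mat 1)" ..
      \<comment> \<open>The inner product of \<open>x0\<close> with a scalar matrix is the real part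
        of a multiple of \<open>trace x0\<close>, which is 0.\<close>
      then have "cadj v = cscale (cnj c) (mat 1)"
        by (auto simp: vec_eq_iff cadj_def cscale_def mat_def)
      moreover have "x0 ** cscale (cnj c) (mat 1) = cscale (cnj c) (x0 ** mat 1)"
        unfolding cscale_def matrix_matrix_mult_def by (simp add: vec_eq_iff sum_distrib_left mult_ac)
      ultimately have "x0 ** cadj v = cscale (cnj c) x0" by simp
      moreover have "trace (cscale (cnj c) x0) = cnj c * trace x0"
        by (simp add: trace_def cscale_def sum_distrib_left)
      ultimately show ?thesis by (simp add: inner_cmat tr0)
    qed
  qed (use assms(5-8) in auto)
  show ?thesis
    using AE_time_average AE_tau_pos
  proof eventually_elim
    case (elim \<omega>)
    let ?X = "Xpath H1 H2 tau \<omega>"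
    define y where "y = (\<lambda>t. conj_by (?X t) x0)"
    have orb: "orb \<omega> j = conj_by (Jprod H1 H2 j (\<lambda>i. tau (i - 1) \<omega>)) x0" for j
    proof (induction j)
      case (Suc j)
      have "orb \<omega> (Suc j) = T (even j) (tau j \<omega>) (orb \<omega> j)" by simp
      also have "\<dots> = conj_by (evol (if even j then H1 else H2) (tau j \<omega>)) (orb \<omega> j)" by (rule T)
      finally show ?case unfolding Suc by (simp add: conj_by_mult)
    qed (simp add: conj_by_1)
    have "y t = T (even j) (t - switch_time tau \<omega> j) (orb \<omega> j)"
      if "switch_time tau \<omega> j \<le> t" "t < switch_time tau \<omega> (Suc j)" for j t
      unfolding T orb y_def conj_by_mult[symmetric]
      by (subst Xpath_on_interval[OF _ that]) (use elim(2) in auto)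
    with elim(1) have int: "y integrable_on {0..t}" and lim: "((\<lambda>t. (1 / t) *\<^sub>R integral {0..t} y) \<longlongrightarrow> 0) at_top" for t
      by blast+
    \<comment> \<open>Conjugation leaves the scalar part \<open>E\<close> alone, so only the
      traceless part \<open>y\<close> evolves.\<close>
    have \<rho>: "?X t ** \<rho>0 ** cadj (?X t) = E + y t" for t
    proof -
      have "conj_by (?X t) E = E"
        unfolding E_def using assms(9,10) by (intro conj_by_scalar Xpath_unitary)
      then show ?thesis
        unfolding y_def x0_def linear_diff[OF linear_conj_by] by (simp add: conj_by_def)
    qed
    show ?case
    proof (intro allI impI)
      fix A :: "complex^'n^'n"
      \<comment> \<open>As a real-linear map on a finite-dimensional space, \<open>L\<close> is
        bounded and commutes with the integral of the matrix-valued path.\<close>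
      define L where "L = (\<lambda>v. trace (v ** A))"
      have "linear L"
        unfolding L_def
        by (rule linearI)
          (simp_all add: trace_def matrix_matrix_mult_def algebra_simps sum.distrib scaleR_sum_right)
      then have L: "bounded_linear L" by (simp add: linear_conv_bounded_linear)
      have "((\<lambda>t. L E + L ((1 / t) *\<^sub>R integral {0..t} y)) \<longlongrightarrow> L E + L 0) at_top"
        by (intro tendsto_intros bounded_linear.tendsto[OF L] lim)
      then have "((\<lambda>t. L E + L ((1 / t) *\<^sub>R integral {0..t} y)) \<longlongrightarrow> L E) at_top"
        by (simp add: linear_0[OF \<open>linear L\<close>])
      \<comment> \<open>For positive \<open>t\<close> the constant part integrates to
        \<open>t\<close> times \<open>L E\<close>, and the division by \<open>t\<close> restores
        \<open>L E\<close>.\<close>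
      moreover have "\<forall>\<^sub>F t in at_top. L E + L ((1 / t) *\<^sub>R integral {0..t} y)
          = (1 / complex_of_real t) * integral {0..t} (\<lambda>t. L (E + y t))"
        using eventually_gt_at_top[of 0]
      proof eventually_elim
        case (elim t)
        have "integral {0..t} (\<lambda>t. L (E + y t)) = integral {0..t} (\<lambda>s. L E + (L \<circ> y) s)"
          by (simp add: linear_add[OF \<open>linear L\<close>])
        also have "\<dots> = t *\<^sub>R L E + integral {0..t} (L \<circ> y)"
          using elim integrable_linear[OF int L]
          by (subst Henstock_Kurzweil_Integration.integral_add) auto
        also have "integral {0..t} (L \<circ> y) = L (integral {0..t} y)"
          by (rule integral_linear[OF int L])
        finally have "integral {0..t} (\<lambda>t. L (E + y t)) = t *\<^sub>R L E + L (integral {0..t} y)" .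
        then show ?case
          using elim unfolding linear_scale[OF \<open>linear L\<close>]
          by (simp add: scaleR_conv_of_real[where 'a = complex] field_simps)
      qed
      ultimately have "((\<lambda>t. (1 / complex_of_real t) * integral {0..t} (\<lambda>t. L (E + y t))) \<longlongrightarrow> L E) at_top"
        by (rule Lim_transform_eventually)
      then show "((\<lambda>T. (1 / complex_of_real T) *
          integral {0..T} (\<lambda>t. trace ((?X t ** \<rho>0 ** cadj (?X t)) ** A)))
          \<longlongrightarrow> trace (cscale (1 / of_nat CARD('n)) (mat 1) ** A)) at_top"
        unfolding \<rho> by (simp add: L_def E_def N_def)
    qed
  qed
qed

end
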